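(* Let $G=(V,E)$ be a connected undirected simple graph with $n$ vertices and $m$ edges, $k$ a positive integer, and $v_i\in V$. The call ENUM-V$(G,\{v_i\},k)$ runs in $O(N_i\cdot k^2)$ time and $O(n+m)$ space, where $N_i$ is the number of $k$-graphlets of $G$ that contain $v_i$.
   Context: A $k$-graphlet is a connected subgraph induced by exactly $k$ vertices. $N(U)=\bigcup_{u\in U}N(u)\setminus U$. A vertex $v$ is mandatory for $G,\mathit{In},k$ if the connected component of $G-v$ containing $\mathit{In}$ has at most $k-1$ vertices; this is tested by a breadth-first search from $\mathit{In}$ that stops as soon as $k$ vertices are found. LIN-ENUM-V$(G,\mathit{In},k)$: if $|\mathit{In}|=k$ output $\mathit{In}$ and return; while $N(\mathit{In})$ has a mandatory vertex $u$, add $u$ to $\mathit{In}$ (outputting and returning if $|\mathit{In}|=k$); then pick $v\in N(\mathit{In})$ and call LIN-ENUM-V$(G,\mathit{In}\cup\{v\},k)$ and LIN-ENUM-V$(G-v,\mathit{In},k)$. ENUM-V$(G,\mathit{In},k)$: (1) if $|\mathit{In}|=k-1$, output $\mathit{In}\cup\{u\}$ for every $u\in N(\mathit{In})$, then return; (2) while $|N(\mathit{In})|=1$: let $v$ be the unique vertex of $N(\mathit{In})$, set $\mathit{In}\gets\mathit{In}\cup\{v\}$, and if $|\mathit{In}|=k-1$, output $\mathit{In}\cup\{u\}$ for every $u\in N(\mathit{In})$ and return; (3) let $x,y$ be two distinct vertices of $N(\mathit{In})$; if one of them, say $z$, is non-mandatory for $G,\mathit{In},k$, call ENUM-V$(G,\mathit{In}\cup\{z\},k)$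 and then ENUM-V$(G-z,\mathit{In},k)$; otherwise call LIN-ENUM-V$(G,\mathit{In},k)$. The graph is stored in adjacency lists (single dynamic copy, changes undone on backtracking), with vertex deletion in $O(\deg(v))$ time.
   Formalization: ENUM-V also outputs In if |In|=k (needed for k=1) and returns if N(In) is empty; the time bound uses max(1,N_i); LIN-ENUM-V finds all mandatory vertices in one pass on a sparse subgraph, since a BFS per vertex costs Θ(k^4) on K_{k+1}, which has only k such graphlets. *)

theory Defs
  imports Main
begin

section \<open>Graphs and graphlets\<close>

definition simple_graph :: "'v set \<Rightarrow> 'v set set \<Rightarrow> bool" where
  "simple_graph V E \<longleftrightarrow> finite V \<and> (\<forall>e\<in>E. \<exists>u\<in>V. \<exists>w\<in>V. u \<noteq> w \<and> e = {u, w})"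

definition connected_graph :: "'v set \<Rightarrow> 'v set set \<Rightarrow> bool" where
  "connected_graph V E \<longleftrightarrow> V \<noteq> {} \<and> (\<forall>u\<in>V. \<forall>w\<in>V. (u, w) \<in> {(x, y). {x, y} \<in> E}\<^sup>*)"

definition induced_edges :: "'v set set \<Rightarrow> 'v set \<Rightarrow> 'v set set" where
  "induced_edges E U = {e \<in> E. e \<subseteq> U}"

text \<open>An induced subgraph is identified with its vertex set.\<close>

definition graphlets :: "'v set \<Rightarrow> 'v set set \<Rightarrow> nat \<Rightarrow> 'v set set" where
  "graphlets V E k = {U. U \<subseteq> V \<and> card U = k \<and> connected_graph U (induced_edges E U)}"

definition graphlets_containing :: "'v set \<Rightarrow> 'v set set \<Rightarrow> nat \<Rightarrow> 'v \<Rightarrow> 'v set set" where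
  "graphlets_containing V E k v = {U \<in> graphlets V E k. v \<in> U}"

section \<open>Adjacency lists\<close>

type_synonym 'v adj = "'v \<Rightarrow> 'v list"

definition adjacency_lists :: "'v set \<Rightarrow> 'v set set \<Rightarrow> 'v adj \<Rightarrow> bool" where
  "adjacency_lists V E g \<longleftrightarrow>
     (\<forall>u\<in>V. distinct (g u) \<and> set (g u) = {w. {u, w} \<in> E}) \<and> (\<forall>u. u \<notin> V \<longrightarrow> g u = [])"

definition del_vertex :: "'v \<Rightarrow> 'v adj \<Rightarrow> 'v adj" where
  "del_vertex z g = (\<lambda>u. if u = z then [] else removeAll z (g u))"

definition component :: "'v adj \<Rightarrow> 'v set \<Rightarrow> 'v set" where
  "component g A = {(x, y). y \<in> set (g x)}\<^sup>* `` A"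

definition mandatory :: "'v adj \<Rightarrow> 'v list \<Rightarrow> nat \<Rightarrow> 'v \<Rightarrow> bool" where
  "mandatory g In k v \<longleftrightarrow> card (component (del_vertex v g) (set In)) \<le> k - 1"

section \<open>Elementary routines with their costs\<close>

text \<open>
  The cost model is a unit-cost RAM. One time unit stands for a constant number of machine
  operations: inspecting one cell of an adjacency list (with the lookup of the mark bit of the
  vertex in it and, if it is new, setting that bit, storing the vertex, and resetting the bit when
  the routine ends), or starting one loop iteration or one call. One space unit is one machine
  word. A set argument is an array of mark bits, so membership and insertion are elementary.
  Every routine returns its result together with the time and, where it is not constant, the
  working space that it uses.

  \<open>scan Z r xs\<close> traverses \<open>xs\<close> and collects the vertices outside \<open>Z\<close>, each once, until \<open>r\<close> of them
  are found.
\<close>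

fun scan :: "'v set \<Rightarrow> nat \<Rightarrow> 'v list \<Rightarrow> 'v list \<times> nat" where
  "scan Z 0 xs = ([], 0)"
| "scan Z (Suc r) [] = ([], 0)"
| "scan Z (Suc r) (x # xs) =
     (if x \<in> Z then (let (ys, t) = scan Z (Suc r) xs in (ys, 1 + t))
      else (let (ys, t) = scan (insert x Z) r xs in (x # ys, 1 + t)))"

text \<open>
  Up to \<open>r\<close> vertices of \<open>N(In)\<close> that are adjacent to a vertex of the list \<open>F\<close>; with \<open>F = In\<close> these
  are up to \<open>r\<close> vertices of \<open>N(In)\<close>.
\<close>

definition neighbours :: "'v adj \<Rightarrow> 'v list \<Rightarrow> 'v list \<Rightarrow> nat \<Rightarrow> 'v list \<times> nat" where
  "neighbours g In F r =
     (let (ws, t) = scan (set In) r (concat (map g F)) in (ws, length F + t))"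

definition all_neighbours :: "'v adj \<Rightarrow> 'v list \<Rightarrow> 'v list \<times> nat" where
  "all_neighbours g In = neighbours g In In (length (concat (map g In)))"

text \<open>
  Breadth-first search with queue \<open>q\<close>, skipping the vertices of \<open>Z\<close>, that stops as soon as \<open>r\<close> new
  vertices are found. The result is the list of the tree edges (parent, child) in the order of
  discovery.
\<close>

function bfs :: "'v adj \<Rightarrow> nat \<Rightarrow> 'v list \<Rightarrow> 'v set \<Rightarrow> ('v \<times> 'v) list \<times> nat" where
  "bfs g r [] Z = ([], 1)"
| "bfs g r (u # q) Z =
     (if r = 0 then ([], 1)
      else (let (ws, t) = scan Z r (g u);
                (es, t') = bfs g (r - length ws) (q @ ws) (Z \<union> set ws)
            in (map (Pair u) ws @ es, 1 + t + t')))"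
  by pat_completeness auto
termination
proof (relation "measures [\<lambda>(g, r, q, Z). r, \<lambda>(g, r, q, Z). length q]", goal_cases)
  case (2 g r u q Z x ws t)
  then show ?case by (cases ws) auto
qed simp

definition mandatory_test :: "'v adj \<Rightarrow> 'v list \<Rightarrow> nat \<Rightarrow> 'v \<Rightarrow> bool \<times> nat \<times> nat" where
  "mandatory_test g In k z =
     (let (es, t) = bfs g (k - length In) In (insert z (set In))
      in (length In + length es \<le> k - 1, length In + t, length In + length es))"

section \<open>LIN-ENUM-V\<close>

fun select_mandatory :: "'v adj \<Rightarrow> 'v list \<Rightarrow> nat \<Rightarrow> 'v list \<Rightarrow> 'v list \<times> nat \<times> nat" where
  "select_mandatory h In k [] = ([], 1, 0)"
| "select_mandatory h In k (u # us) =
     (let (b, t, s) = mandatory_test h In k u; (M, t', s') = select_mandatory h In k us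
      in (if b then u # M else M, 1 + t + t', max s s'))"

fun forest :: "nat \<Rightarrow> 'v adj \<Rightarrow> 'v list \<Rightarrow> 'v set \<Rightarrow> ('v \<times> 'v) list \<times> nat" where
  "forest n g [] Z = ([], 1)"
| "forest n g (u # us) Z =
     (if u \<in> Z then (let (fs, t) = forest n g us Z in (fs, 1 + t))
      else (let (es, t) = bfs g n [u] (insert u Z);
                (fs, t') = forest n g us (insert u Z \<union> snd ` set es)
            in (es @ fs, 1 + t + t')))"

definition edge_lists :: "('v \<times> 'v) list \<Rightarrow> 'v adj" where
  "edge_lists es =
     (\<lambda>u. map snd (filter (\<lambda>e. fst e = u) es) @ map fst (filter (\<lambda>e. snd e = u) es))"

text \<open>
  All mandatory vertices, in time proportional to the number of edges of the component \<open>C\<close> of \<open>In\<close>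
  plus the square of its number of vertices. One search per vertex on the full lists would be too
  slow (by a factor \<open>k\<close> on the complete graph with \<open>k + 1\<close> vertices), so the searches run on a
  subgraph \<open>h\<close> with fewer than \<open>2 |C|\<close> edges: a breadth-first tree \<open>T\<close> grown from \<open>In\<close>, and a spanning
  forest \<open>F\<close> of the remaining edges. Deleting a vertex \<open>v\<close> outside \<open>In\<close> leaves the same vertices
  reachable from \<open>In\<close> in \<open>h\<close> as in \<open>g\<close> (\<open>certificate_component\<close>, \<open>mandatory_vertices_iff\<close> below).
  Here \<open>n\<close> is any bound on the number of vertices.
\<close>

definition tree_complement :: "'v adj \<Rightarrow> ('v \<times> 'v) list \<Rightarrow> 'v adj" where
  "tree_complement g T = (\<lambda>u. filter (\<lambda>w. (u, w) \<notin> set T \<and> (w, u) \<notin> set T) (g u))"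

definition mandatory_vertices :: "nat \<Rightarrow> 'v adj \<Rightarrow> 'v list \<Rightarrow> nat \<Rightarrow> 'v list \<times> nat \<times> nat" where
  "mandatory_vertices n g In k =
     (let (T, t1) = bfs g n In (set In);
          C = In @ map snd T;
          size_C = (\<Sum>u\<leftarrow>C. 1 + length (g u));
          (F, t2) = forest n (tree_complement g T) C {};
          size_h = length C + 2 * length (T @ F);
          (M, t3, s3) = select_mandatory (edge_lists (T @ F)) In k (map snd T)
      in (M, length In + t1 + size_C + t2 + size_h + t3,
          length C + size_C + length (T @ F) + size_h + length M + s3))"

text \<open>
  The while loop of LIN-ENUM-V. A vertex is mandatory for \<open>In\<close> iff it is mandatory for \<open>In\<close>
  extended by mandatory vertices (\<open>mandatory_add\<close> below), so the mandatory vertices \<open>M\<close> are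
  computed once; the loop is then a search from \<open>In\<close> that only enters vertices of \<open>M\<close> (hence the marks \<open>- set M\<close>) and stops when
  \<open>k\<close> vertices are reached.
\<close>

definition add_mandatory :: "nat \<Rightarrow> 'v adj \<Rightarrow> 'v list \<Rightarrow> nat \<Rightarrow> 'v list \<times> nat \<times> nat" where
  "add_mandatory n g In k =
     (let (M, t1, s1) = mandatory_vertices n g In k;
          (es, t2) = bfs g (k - length In) In (- set M)
      in (In @ map snd es, t1 + length M + length In + t2, s1 + length In + length es))"

text \<open>
  \<open>lin_enum_v n k g In out t s\<close>: the call LIN-ENUM-V\<open>(g, In, k)\<close> returns after time \<open>t\<close>, having
  written the sequence \<open>out\<close> of vertex sets to the output stream and used at most \<open>s\<close> words on top
  of the global data. An output costs \<open>k\<close> time units. There is a single dynamic copy of the graph: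
  deleting \<open>z\<close> and undoing this cost \<open>1 + deg z\<close> each, and on return the vertices added to \<open>In\<close> are
  removed again. A stack frame takes 2 words and one word for each vertex added to \<open>In\<close>.
\<close>

definition update_time :: "'v adj \<Rightarrow> 'v \<Rightarrow> nat" where
  "update_time g z = 2 * (1 + length (g z))"

inductive lin_enum_v ::
  "nat \<Rightarrow> nat \<Rightarrow> 'v adj \<Rightarrow> 'v list \<Rightarrow> 'v set list \<Rightarrow> nat \<Rightarrow> nat \<Rightarrow> bool" for n k where
  lin_full:
  "length In = k \<Longrightarrow> lin_enum_v n k g In [set In] (1 + k) 2"
| lin_filled:
  "\<lbrakk>length In \<noteq> k; add_mandatory n g In k = (In', t0, s0); a = length In' - length In;
    length In' = k\<rbrakk>
   \<Longrightarrow> lin_enum_v n k g In [set In'] (1 + t0 + k + a) (2 + a + s0)"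
| lin_branch:
  "\<lbrakk>length In \<noteq> k; add_mandatory n g In k = (In', t0, s0); a = length In' - length In;
    length In' \<noteq> k; neighbours g In' In' 1 = ([v], t1);
    lin_enum_v n k g (In' @ [v]) out2 t2 s2;
    lin_enum_v n k (del_vertex v g) In' out3 t3 s3\<rbrakk>
   \<Longrightarrow> lin_enum_v n k g In (out2 @ out3)
         (1 + t0 + t1 + 2 + t2 + update_time g v + t3 + a)
         (2 + a + max s0 (max (1 + s2) s3))"
| lin_stuck:
  "\<lbrakk>length In \<noteq> k; add_mandatory n g In k = (In', t0, s0); a = length In' - length In;
    length In' \<noteq> k; neighbours g In' In' 1 = ([], t1)\<rbrakk>
   \<Longrightarrow> lin_enum_v n k g In [] (1 + t0 + t1 + a) (2 + a + s0)"

section \<open>ENUM-V\<close>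

text \<open>
  The while loop that runs as long as \<open>|N(In)| = 1\<close>; \<open>r\<close> is the number of vertices missing to
  \<open>|In| = k - 1\<close>. After the unique vertex \<open>v\<close> of \<open>N(In)\<close> is added, \<open>N(In)\<close> consists of neighbours
  of \<open>v\<close>, so only the list of \<open>v\<close> is traversed, and only until two vertices are found. The result
  is the new \<open>In\<close> and, unless \<open>|In| = k - 1\<close>, two vertices of \<open>N(In)\<close> (none if \<open>N(In)\<close> is empty).
\<close>

fun extend :: "'v adj \<Rightarrow> nat \<Rightarrow> 'v list \<Rightarrow> 'v list \<Rightarrow> 'v list \<times> 'v list \<times> nat" where
  "extend g 0 F In = (In, [], 1)"
| "extend g (Suc r) F In =
     (let (ws, t) = neighbours g In F 2
      in case ws of
           [v] \<Rightarrow> (let (In', ws', t') = extend g r [v] (In @ [v]) in (In', ws', 1 + t + t'))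
         | _ \<Rightarrow> (In, ws, 1 + t))"

text \<open>
  The arguments are those of \<open>lin_enum_v\<close>. The rule \<open>enum_full\<close> only applies to a call with
  \<open>|In| = k\<close>; from \<open>|In| = 1\<close> this happens for \<open>k = 1\<close> only, where \<open>In\<close> itself is the only
  \<open>k\<close>-graphlet. The rules \<open>enum_stuck\<close> and \<open>lin_stuck\<close> apply if \<open>N(In)\<close> is empty before \<open>k\<close> vertices
  are reached, which only happens if the graph has fewer than \<open>k\<close> vertices: the call returns without
  output.
\<close>

inductive enum_v ::
  "nat \<Rightarrow> nat \<Rightarrow> 'v adj \<Rightarrow> 'v list \<Rightarrow> 'v set list \<Rightarrow> nat \<Rightarrow> nat \<Rightarrow> bool" for n k where
  enum_full:
  "length In = k \<Longrightarrow> enum_v n k g In [set In] (1 + k) 2"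
| enum_leaf:
  "\<lbrakk>length In \<noteq> k; extend g (k - 1 - length In) In In = (In', ws, t0); a = length In' - length In;
    length In' = k - 1; all_neighbours g In' = (us, t1)\<rbrakk>
   \<Longrightarrow> enum_v n k g In (map (\<lambda>u. insert u (set In')) us)
         (1 + t0 + t1 + k * length us + a)
         (2 + a + length us)"
| enum_stuck:
  "\<lbrakk>length In \<noteq> k; extend g (k - 1 - length In) In In = (In', [], t0); a = length In' - length In;
    length In' \<noteq> k - 1\<rbrakk>
   \<Longrightarrow> enum_v n k g In [] (1 + t0 + a) (2 + a)"
| enum_branch_first:
  "\<lbrakk>length In \<noteq> k; extend g (k - 1 - length In) In In = (In', [x, y], t0);
    a = length In' - length In; length In' \<noteq> k - 1;
    mandatory_test g In' k x = (False, tx, sx);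
    enum_v n k g (In' @ [x]) out1 t1 s1;
    enum_v n k (del_vertex x g) In' out2 t2 s2\<rbrakk>
   \<Longrightarrow> enum_v n k g In (out1 @ out2)
         (1 + t0 + tx + 2 + t1 + update_time g x + t2 + a)
         (2 + a + max sx (max (1 + s1) s2))"
| enum_branch_second:
  "\<lbrakk>length In \<noteq> k; extend g (k - 1 - length In) In In = (In', [x, y], t0);
    a = length In' - length In; length In' \<noteq> k - 1;
    mandatory_test g In' k x = (True, tx, sx); mandatory_test g In' k y = (False, ty, sy);
    enum_v n k g (In' @ [y]) out1 t1 s1;
    enum_v n k (del_vertex y g) In' out2 t2 s2\<rbrakk>
   \<Longrightarrow> enum_v n k g In (out1 @ out2)
         (1 + t0 + tx + ty + 2 + t1 + update_time g y + t2 + a)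
         (2 + a + max (max sx sy) (max (1 + s1) s2))"
| enum_lin:
  "\<lbrakk>length In \<noteq> k; extend g (k - 1 - length In) In In = (In', [x, y], t0);
    a = length In' - length In; length In' \<noteq> k - 1;
    mandatory_test g In' k x = (True, tx, sx); mandatory_test g In' k y = (True, ty, sy);
    lin_enum_v n k g In' out1 t1 s1\<rbrakk>
   \<Longrightarrow> enum_v n k g In out1
         (1 + t0 + tx + ty + t1 + a)
         (2 + a + max (max sx sy) s1)"

text \<open>
  The call ENUM-V\<open>(G, {v}, k)\<close> on a graph stored in adjacency lists. Its space is that of the
  lists (one word for the head of each list, three for each of its cells: the vertex, a link, and a
  pointer to the opposite cell), of three arrays of marks and parents, of the initial \<open>In\<close>, and of
  the call itself. The adjacency lists and the cleared arrays are given when the call starts.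
\<close>

definition enum_v_call ::
  "'v set \<Rightarrow> 'v adj \<Rightarrow> nat \<Rightarrow> 'v \<Rightarrow> 'v set list \<Rightarrow> nat \<Rightarrow> nat \<Rightarrow> bool" where
  "enum_v_call V g k v out t s \<longleftrightarrow>
     (\<exists>s'. enum_v (card V) k g [v] out t s' \<and>
           s = card V + 3 * (\<Sum>u\<in>V. length (g u)) + 3 * card V + 1 + s')"

section \<open>The tests decide the mandatory vertices\<close>

lemma scan_props:
  assumes "scan Z r xs = (ys, t)"
  shows "distinct ys" "set ys \<subseteq> set xs - Z" "length ys \<le> r"
    "length ys < r \<Longrightarrow> set xs \<subseteq> Z \<union> set ys"
  using assms
  by (induction Z r xs arbitrary: ys t rule: scan.induct)
     (fastforce split: if_splits prod.splits)+

lemma bfs_props: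
  assumes "bfs g r q Z = (es, t)"
  shows "distinct (map snd es) \<and> snd ` set es \<inter> Z = {} \<and> length es \<le> r \<and>
    (\<forall>(p, w) \<in> set es. w \<in> set (g p)) \<and> fst ` set es \<subseteq> set q \<union> snd ` set es \<and>
    snd ` set es \<subseteq> (set es)\<^sup>* `` set q \<and>
    (length es < r \<longrightarrow> (\<forall>x \<in> set q \<union> snd ` set es. set (g x) \<subseteq> Z \<union> snd ` set es))"
  using assms
proof (induction g r q Z arbitrary: es t rule: bfs.induct)
  case (1 g r Z)
  then show ?case by auto
next
  case (2 g r u q Z)
  show ?case
  proof (cases "r = 0")
    case True
    then show ?thesis using 2 by auto
  next
    case False
    obtain ws t1 where ws: "scan Z r (g u) = (ws, t1)" by fastforce
    obtain es' t2 where es': "bfs g (r - length ws) (q @ ws) (Z \<union> set ws) = (es', t2)" by fastforce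
    have es: "es = map (Pair u) ws @ es'" using 2(2) False ws es' by simp
    note IH = 2(1)[OF False ws[symmetric] refl es']
    note sc = scan_props[OF ws]
    have snd_es: "snd ` set es = set ws \<union> snd ` set es'"
      unfolding es by force
    have mono: "(set es')\<^sup>* \<subseteq> (set es)\<^sup>*"
      unfolding es by (intro rtrancl_mono) auto
    have wse: "w \<in> (set es)\<^sup>* `` set (u # q)" if "w \<in> set ws" for w
    proof -
      have "(u, w) \<in> set es" using that unfolding es by auto
      then show ?thesis by auto
    qed
    have a: "distinct (map snd es)"
      using IH sc(1) unfolding es by (auto simp: comp_def)
    have b: "snd ` set es \<inter> Z = {}" using IH sc(2) snd_es by auto
    have c: "length es \<le> r" using IH sc(3) unfolding es by auto
    have d: "\<forall>(p, w) \<in> set es. w \<in> set (g p)" using IH sc(2) unfolding es by auto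
    have e: "fst ` set es \<subseteq> set (u # q) \<union> snd ` set es"
      using IH snd_es unfolding es by auto
    have f: "snd ` set es \<subseteq> (set es)\<^sup>* `` set (u # q)"
    proof
      fix w assume "w \<in> snd ` set es"
      then consider "w \<in> set ws" | "w \<in> snd ` set es'" using snd_es by auto
      then show "w \<in> (set es)\<^sup>* `` set (u # q)"
      proof cases
        case 1
        then show ?thesis by (rule wse)
      next
        case 2
        then obtain x where x: "x \<in> set (q @ ws)" "(x, w) \<in> (set es')\<^sup>*" using IH by blast
        then have xw: "(x, w) \<in> (set es)\<^sup>*" using mono by auto
        show ?thesis
        proof (cases "x \<in> set ws")
          case True
          then obtain y where "y \<in> set (u # q)" "(y, x) \<in> (set es)\<^sup>*" using wse by blast
          then show ?thesis using xw by (meson ImageI rtrancl_trans)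
        next
          case False
          then show ?thesis using x xw by auto
        qed
      qed
    qed
    have h: "set (g x) \<subseteq> Z \<union> snd ` set es"
      if "length es < r" and x: "x \<in> set (u # q) \<union> snd ` set es" for x
    proof -
      have l: "length ws < r" "length es' < r - length ws" using that(1) unfolding es by auto
      show ?thesis
      proof (cases "x = u")
        case True
        then show ?thesis using sc(4)[OF l(1)] snd_es by auto
      next
        case False
        then have "x \<in> set (q @ ws) \<union> snd ` set es'" using x snd_es by auto
        then have "set (g x) \<subseteq> Z \<union> set ws \<union> snd ` set es'" using IH l(2) by blast
        then show ?thesis using snd_es by auto
      qed
    qed
    have hh: "length es < r \<longrightarrow>
        (\<forall>x \<in> set (u # q) \<union> snd ` set es. set (g x) \<subseteq> Z \<union> snd ` set es)"
      by (intro impI ballI h)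
    show ?thesis by (intro conjI a b c d e f hh)
  qed
qed

lemma bfs_facts:
  assumes "bfs g r q Z = (es, t)"
  shows "distinct (map snd es)" "snd ` set es \<inter> Z = {}" "length es \<le> r"
    "\<And>p w. (p, w) \<in> set es \<Longrightarrow> w \<in> set (g p)" "fst ` set es \<subseteq> set q \<union> snd ` set es"
    "snd ` set es \<subseteq> (set es)\<^sup>* `` set q"
    "\<And>x. \<lbrakk>length es < r; x \<in> set q \<union> snd ` set es\<rbrakk> \<Longrightarrow> set (g x) \<subseteq> Z \<union> snd ` set es"
  using bfs_props[OF assms] by simp_all blast+

lemma bfs_order:
  assumes "bfs g r q Z = (es, t)" "distinct q" "set q \<subseteq> Z" "length es < r"
  shows "\<exists>f :: 'v \<Rightarrow> nat. \<forall>(p, w) \<in> set es.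
    f p < f w \<and> (\<forall>v \<in> set q \<union> snd ` set es. w \<in> set (g v) \<longrightarrow> f p \<le> f v)"
  using assms
proof (induction g r q Z arbitrary: es t rule: bfs.induct)
  case (1 g r Z)
  then show ?case by auto
next
  case (2 g r u q Z)
  have False': "r \<noteq> 0" using 2(5) by auto
  obtain ws t1 where ws: "scan Z r (g u) = (ws, t1)" by fastforce
  obtain es' t2 where es': "bfs g (r - length ws) (q @ ws) (Z \<union> set ws) = (es', t2)" by fastforce
  have es: "es = map (Pair u) ws @ es'" using 2(2) False' ws es' by simp
  note sc = scan_props[OF ws]
  note pr = bfs_facts[OF es']
  have l: "length ws < r" "length es' < r - length ws" using 2(5) unfolding es by auto
  have "distinct (q @ ws)" "set (q @ ws) \<subseteq> Z \<union> set ws" using 2(3,4) sc by auto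
  from 2(1)[OF False' ws[symmetric] refl es' this l(2)]
  obtain f :: "'v \<Rightarrow> nat" where f: "\<forall>(p, w) \<in> set es'.
    f p < f w \<and> (\<forall>v \<in> set (q @ ws) \<union> snd ` set es'. w \<in> set (g v) \<longrightarrow> f p \<le> f v)" by blast
  define f' where "f' x = (if x = u then 0 else Suc (f x))" for x
  have uq: "u \<notin> set q" and uZ: "u \<in> Z" using 2(3,4) by auto
  have uws: "u \<notin> set ws" using sc(2) uZ by auto
  have ues: "u \<notin> snd ` set es'" using pr(2) uZ by blast
  have gu: "set (g u) \<subseteq> Z \<union> set ws" using sc(4)[OF l(1)] .
  have "f' p < f' w \<and> (\<forall>v \<in> set (u # q) \<union> snd ` set es. w \<in> set (g v) \<longrightarrow> f' p \<le> f' v)"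
    if pw: "(p, w) \<in> set es" for p w
  proof (cases "(p, w) \<in> set es'")
    case True
    then have w: "w \<in> snd ` set es'" by force
    then have wn: "w \<noteq> u" "w \<notin> Z \<union> set ws" using ues pr(2) by blast+
    have p: "p \<in> set (q @ ws) \<union> snd ` set es'" using pr(5) True by force
    then have pn: "p \<noteq> u" using uq uws ues by auto
    have fpw: "f p < f w" "\<And>v. v \<in> set (q @ ws) \<union> snd ` set es' \<Longrightarrow> w \<in> set (g v) \<Longrightarrow> f p \<le> f v"
      using f True by blast+
    have "f' p \<le> f' v" if v: "v \<in> set (u # q) \<union> snd ` set es" "w \<in> set (g v)" for v
    proof -
      have "v \<noteq> u" using v(2) gu wn by auto
      moreover have "v \<in> set (q @ ws) \<union> snd ` set es'"
        using v(1) \<open>v \<noteq> u\<close> unfolding es by (auto simp: image_Un image_image)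
      ultimately show ?thesis using fpw(2) v(2) pn by (simp add: f'_def)
    qed
    then show ?thesis using fpw(1) wn pn by (simp add: f'_def)
  next
    case False
    then have "p = u" "w \<in> set ws" using pw unfolding es by auto
    then show ?thesis using uws by (auto simp: f'_def)
  qed
  then show ?case by blast
qed

lemma component_closed:
  assumes "A \<subseteq> B" "\<And>x y. x \<in> B \<Longrightarrow> y \<in> set (g x) \<Longrightarrow> y \<in> B"
  shows "component g A \<subseteq> B"
proof
  fix y assume "y \<in> component g A"
  then obtain x where "x \<in> A" "(x, y) \<in> {(x, y). y \<in> set (g x)}\<^sup>*" by (auto simp: component_def)
  from this(2,1) show "y \<in> B" by (induction rule: rtrancl_induct) (use assms in auto)
qed

lemma component_base: "A \<subseteq> component g A"
  by (auto simp: component_def)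

lemma component_step: "x \<in> component g A \<Longrightarrow> y \<in> set (g x) \<Longrightarrow> y \<in> component g A"
  unfolding component_def by (auto intro: rtrancl_into_rtrancl)

lemma set_del_vertex: "y \<in> set (del_vertex z g x) \<longleftrightarrow> x \<noteq> z \<and> y \<noteq> z \<and> y \<in> set (g x)"
  by (auto simp: del_vertex_def)

lemma bfs_subset_component:
  assumes "bfs g r q Z = (es, t)" "z \<in> Z" "z \<notin> set q"
  shows "snd ` set es \<subseteq> component (del_vertex z g) (set q)"
proof -
  note pr = bfs_facts[OF assms(1)]
  have ne: "z \<notin> snd ` set es" "z \<notin> fst ` set es" using pr(2,5) assms(2,3) by blast+
  have "set es \<subseteq> {(x, y). y \<in> set (del_vertex z g x)}"
  proof
    fix e assume e: "e \<in> set es"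
    then have "fst e \<noteq> z" "snd e \<noteq> z" using ne by (metis image_eqI)+
    moreover have "snd e \<in> set (g (fst e))" using pr(4) e by (metis prod.collapse)
    ultimately show "e \<in> {(x, y). y \<in> set (del_vertex z g x)}"
      by (auto simp: set_del_vertex split: prod.split)
  qed
  then have "(set es)\<^sup>* \<subseteq> {(x, y). y \<in> set (del_vertex z g x)}\<^sup>*" by (rule rtrancl_mono)
  then show ?thesis using pr(6) unfolding component_def by blast
qed

lemma mandatory_test_iff:
  assumes "mandatory_test g In k z = (b, t, s)" "distinct In" "z \<notin> set In" "0 < k"
    "finite (component (del_vertex z g) (set In))"
  shows "b \<longleftrightarrow> mandatory g In k z"
proof -
  obtain es t' where es: "bfs g (k - length In) In (insert z (set In)) = (es, t')" by fastforce
  have b: "b \<longleftrightarrow> length In + length es \<le> k - 1"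
    using assms(1) es by (auto simp: mandatory_test_def)
  let ?C = "component (del_vertex z g) (set In)"
  let ?S = "set In \<union> snd ` set es"
  note pr = bfs_facts[OF es]
  have S: "card ?S = length In + length es"
  proof -
    have "card (snd ` set es) = length es"
      using pr(1) by (metis distinct_card length_map list.set_map)
    moreover have "set In \<inter> snd ` set es = {}" using pr(2) by blast
    ultimately show ?thesis using assms(2) by (simp add: card_Un_disjoint distinct_card)
  qed
  have sub: "?S \<subseteq> ?C"
    by (intro Un_least component_base bfs_subset_component[OF es insertI1 assms(3)])
  then have le: "card ?S \<le> card ?C" using assms(5) by (rule card_mono[rotated])
  show ?thesis
  proof (cases "length es < k - length In")
    case True
    have "?C \<subseteq> ?S"
    proof (rule component_closed)
      fix x y assume "x \<in> ?S" "y \<in> set (del_vertex z g x)"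
      then show "y \<in> ?S" using pr(7)[OF True] by (auto simp: set_del_vertex)
    qed simp
    then have "card ?C = length In + length es" using S sub by (metis subset_antisym)
    then show ?thesis using b by (simp add: mandatory_def)
  next
    case False
    then have "k \<le> length In + length es" by simp
    then show ?thesis using b le S assms(4) unfolding mandatory_def by linarith
  qed
qed

lemma forest_props:
  assumes "forest n g us Z = (fs, t)"
  shows "\<forall>(x, y) \<in> set fs. y \<in> set (g x)"
    and "\<And>D. \<lbrakk>\<forall>x y. y \<in> set (g x) \<longrightarrow> x \<in> set (g y); \<forall>x\<in>Z. set (g x) \<subseteq> Z;
      set us \<subseteq> D; \<forall>x\<in>D. set (g x) \<subseteq> D; finite D; card D \<le> n\<rbrakk>
      \<Longrightarrow> \<forall>x \<in> set us - Z. \<forall>y \<in> set (g x). (x, y) \<in> (set fs \<union> (set fs)\<inverse>)\<^sup>*"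
  using assms
proof (induction n g us Z arbitrary: fs t rule: forest.induct)
  case (1 n g Z)
  { case 1 then show ?case by auto }
  { case 2 then show ?case by auto }
next
  case (2 n g u us Z)
  note IH = 2
  show "\<forall>(x, y) \<in> set fs. y \<in> set (g x)" if r: "forest n g (u # us) Z = (fs, t)" for fs t
  proof (cases "u \<in> Z")
    case True
    then show ?thesis using r IH(1)[OF True] by (auto split: prod.splits)
  next
    case False
    obtain es t1 where es: "bfs g n [u] (insert u Z) = (es, t1)" by fastforce
    obtain fs' t2 where fs': "forest n g us (insert u Z \<union> snd ` set es) = (fs', t2)" by fastforce
    have "fs = es @ fs'" using r False es fs' by simp
    then show ?thesis using bfs_facts(4)[OF es] IH(3)[OF False es[symmetric] refl fs'] by auto
  qed
  show "\<forall>x \<in> set (u # us) - Z. \<forall>y \<in> set (g x). (x, y) \<in> (set fs \<union> (set fs)\<inverse>)\<^sup>*"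
    if sym: "\<forall>x y. y \<in> set (g x) \<longrightarrow> x \<in> set (g y)" and cl: "\<forall>x\<in>Z. set (g x) \<subseteq> Z"
      and us: "set (u # us) \<subseteq> D" and D: "\<forall>x\<in>D. set (g x) \<subseteq> D" "finite D" "card D \<le> n"
      and r: "forest n g (u # us) Z = (fs, t)" for D fs t
  proof (cases "u \<in> Z")
    case True
    then obtain t' where "forest n g us Z = (fs, t')" using r by (auto split: prod.splits)
    from IH(2)[OF True sym cl _ D this] us show ?thesis using True by auto
  next
    case False
    obtain es t1 where es: "bfs g n [u] (insert u Z) = (es, t1)" by fastforce
    obtain fs' t2 where fs': "forest n g us (insert u Z \<union> snd ` set es) = (fs', t2)" by fastforce
    have fs: "fs = es @ fs'" using r False es fs' by simp
    note pr = bfs_facts[OF es]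
    let ?W = "insert u (snd ` set es)"
    have "(set es)\<^sup>* `` {u} \<subseteq> D"
    proof
      fix y assume "y \<in> (set es)\<^sup>* `` {u}"
      then have "(u, y) \<in> (set es)\<^sup>*" by simp
      then show "y \<in> D" by (induction rule: rtrancl_induct) (use us D(1) pr(4) in auto)
    qed
    then have WD: "?W \<subseteq> D" using pr(6) us by auto
    have "card ?W = Suc (length es)"
    proof -
      have "card (snd ` set es) = length es"
        using pr(1) by (metis distinct_card length_map list.set_map)
      moreover have "u \<notin> snd ` set es" using pr(2) by blast
      ultimately show ?thesis by simp
    qed
    then have len: "length es < n" using card_mono[OF D(2) WD] D(3) by simp
    have cl1: "set (g x) \<subseteq> insert u Z \<union> snd ` set es" if "x \<in> ?W" for x
      using pr(7)[OF len] that by auto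
    have cl2: "\<forall>x \<in> insert u Z \<union> snd ` set es. set (g x) \<subseteq> insert u Z \<union> snd ` set es"
      using cl1 cl by blast
    have rest: "\<forall>x \<in> set us - (insert u Z \<union> snd ` set es). \<forall>y \<in> set (g x).
        (x, y) \<in> (set fs' \<union> (set fs')\<inverse>)\<^sup>*"
      using IH(4)[OF False es[symmetric] refl sym cl2 _ D fs'] us by simp
    have mono: "(set fs' \<union> (set fs')\<inverse>)\<^sup>* \<subseteq> (set fs \<union> (set fs)\<inverse>)\<^sup>*"
      "(set es)\<^sup>* \<subseteq> (set fs \<union> (set fs)\<inverse>)\<^sup>*"
      "((set es)\<inverse>)\<^sup>* \<subseteq> (set fs \<union> (set fs)\<inverse>)\<^sup>*"
      unfolding fs by (intro rtrancl_mono; auto)+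
    have W: "(u, x) \<in> (set es)\<^sup>*" if "x \<in> ?W" for x using pr(6) that by auto
    show ?thesis
    proof (intro ballI)
      fix x y assume x: "x \<in> set (u # us) - Z" and y: "y \<in> set (g x)"
      show "(x, y) \<in> (set fs \<union> (set fs)\<inverse>)\<^sup>*"
      proof (cases "x \<in> ?W")
        case True
        have "y \<notin> Z" using sym cl x y by blast
        then have "y \<in> ?W" using cl1[OF True] y by auto
        then have "(u, y) \<in> (set fs \<union> (set fs)\<inverse>)\<^sup>*" using W mono by blast
        moreover have "(x, u) \<in> (set fs \<union> (set fs)\<inverse>)\<^sup>*"
          using W[OF True] mono(3) by (auto simp: rtrancl_converse)
        ultimately show ?thesis by (meson rtrancl_trans)
      next
        case False
        then have "x \<in> set us - (insert u Z \<union> snd ` set es)" using x by auto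
        then show ?thesis using rest y mono(1) by blast
      qed
    qed
  qed
qed

lemma set_edge_lists: "y \<in> set (edge_lists es x) \<longleftrightarrow> (x, y) \<in> set es \<or> (y, x) \<in> set es"
  by (force simp: edge_lists_def)

lemma set_tree_complement:
  "y \<in> set (tree_complement g T x) \<longleftrightarrow> y \<in> set (g x) \<and> (x, y) \<notin> set T \<and> (y, x) \<notin> set T"
  by (auto simp: tree_complement_def)

lemma bfs_component:
  assumes "bfs g n In (set In) = (T, t)" "distinct In" "In \<noteq> []"
    "finite (component g (set In))" "card (component g (set In)) \<le> n"
  shows "set In \<union> snd ` set T = component g (set In)" "length T < n"
proof -
  note pr = bfs_facts[OF assms(1)]
  let ?S = "set In \<union> snd ` set T"
  have "set T \<subseteq> {(x, y). y \<in> set (g x)}" using pr(4) by auto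
  then have "(set T)\<^sup>* \<subseteq> {(x, y). y \<in> set (g x)}\<^sup>*" by (rule rtrancl_mono)
  then have sub: "?S \<subseteq> component g (set In)" using pr(6) unfolding component_def by blast
  have "card ?S = length In + length T"
  proof -
    have "card (snd ` set T) = length T"
      using pr(1) by (metis distinct_card length_map list.set_map)
    moreover have "set In \<inter> snd ` set T = {}" using pr(2) by blast
    ultimately show ?thesis using assms(2) by (simp add: card_Un_disjoint distinct_card)
  qed
  then have "length In + length T \<le> n" using card_mono[OF assms(4) sub] assms(5) by simp
  then show len: "length T < n" using assms(3) by (cases In) auto
  have "component g (set In) \<subseteq> ?S"
    by (rule component_closed) (use pr(7)[OF len] in auto)
  then show "?S = component g (set In)" using sub by simp
qed

lemma certificate_component:
  assumes sym: "\<forall>x y. y \<in> set (g x) \<longrightarrow> x \<in> set (g y)"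
    and T: "bfs g n In (set In) = (T, t)" and In: "distinct In" "In \<noteq> []"
    and fin: "finite (component g (set In))" "card (component g (set In)) \<le> n"
    and F: "forest n (tree_complement g T) (In @ map snd T) {} = (F, t')"
    and v: "v \<notin> set In"
  shows "component (del_vertex v (edge_lists (T @ F))) (set In) =
    component (del_vertex v g) (set In)" (is "?A = ?B")
proof
  let ?h = "edge_lists (T @ F)"
  let ?C = "component g (set In)"
  note pr = bfs_facts[OF T]
  note C = bfs_component[OF T In fin]
  have Fsub: "\<forall>(x, y) \<in> set F. y \<in> set (tree_complement g T x)" using forest_props(1)[OF F] .
  have hg: "y \<in> set (g x)" if "y \<in> set (?h x)" for x y
  proof -
    have *: "y \<in> set (g x)" if "(x, y) \<in> set T \<union> set F" for x y
      using that pr(4) Fsub by (auto simp: set_tree_complement)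
    from that show ?thesis using * sym by (auto simp: set_edge_lists)
  qed
  show "?A \<subseteq> ?B"
  proof (rule component_closed[OF component_base])
    fix x y assume x: "x \<in> ?B" and "y \<in> set (del_vertex v ?h x)"
    then have "y \<in> set (del_vertex v g x)" using hg by (simp add: set_del_vertex)
    then show "y \<in> ?B" by (rule component_step[OF x])
  qed
  have hsym: "y \<in> set (?h x) \<Longrightarrow> x \<in> set (?h y)" for x y by (auto simp: set_edge_lists)
  have AC: "?A \<subseteq> ?C"
  proof (rule component_closed[OF component_base])
    fix x y assume x: "x \<in> ?C" and "y \<in> set (del_vertex v ?h x)"
    then have "y \<in> set (g x)" using hg by (simp add: set_del_vertex)
    then show "y \<in> ?C" by (rule component_step[OF x])
  qed
  have vA: "v \<notin> ?A"
  proof -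
    have "?A \<subseteq> - {v}" by (rule component_closed) (use v in \<open>auto simp: set_del_vertex\<close>)
    then show ?thesis by auto
  qed
  have "\<forall>x \<in> ?C. set (tree_complement g T x) \<subseteq> ?C"
    by (auto simp: set_tree_complement intro: component_step)
  then have conn: "(x, y) \<in> (set F \<union> (set F)\<inverse>)\<^sup>*"
    if "x \<in> ?C" "y \<in> set (tree_complement g T x)" for x y
    using forest_props(2)[OF F, of ?C] that fin C sym by (auto simp: set_tree_complement)
  have desc: "(v, y) \<in> (set T)\<^sup>+" if y: "y \<in> ?C" "y \<notin> ?A" "y \<noteq> v" for y
  proof -
    obtain r where r: "r \<in> set In" "(r, y) \<in> (set T)\<^sup>*" using y(1) pr(6) unfolding C(1)[symmetric] by auto
    from r(2) y(2,3) show ?thesis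
    proof (induction rule: rtrancl_induct)
      case base
      then show ?case using r(1) component_base[of "set In" "del_vertex v ?h"] by blast
    next
      case (step x y)
      show ?case
      proof (cases "x = v")
        case True
        then show ?thesis using step by auto
      next
        case False
        have "x \<notin> ?A"
        proof
          assume "x \<in> ?A"
          moreover have "y \<in> set (del_vertex v ?h x)" using step False
            by (simp add: set_del_vertex set_edge_lists)
          ultimately have "y \<in> ?A" by (rule component_step)
          then show False using step by simp
        qed
        then show ?thesis using step False by (meson trancl_into_trancl)
      qed
    qed
  qed
  obtain f :: "'a \<Rightarrow> nat" where f: "\<forall>(p, w) \<in> set T.
    f p < f w \<and> (\<forall>v \<in> set In \<union> snd ` set T. w \<in> set (g v) \<longrightarrow> f p \<le> f v)"
    using bfs_order[OF T In(1) _ C(2)] by auto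
  have fdesc: "f x < f y" if "(x, y) \<in> (set T)\<^sup>+" for x y
    using that by (induction rule: trancl_induct) (use f in \<open>auto dest: order.strict_trans\<close>)
  show "?B \<subseteq> ?A"
  proof (rule component_closed[OF component_base])
    fix a b assume a: "a \<in> ?A" and ab: "b \<in> set (del_vertex v g a)"
    show "b \<in> ?A"
    proof (rule ccontr)
      assume b: "b \<notin> ?A"
      have ab': "a \<noteq> v" "b \<noteq> v" "b \<in> set (g a)" using ab by (auto simp: set_del_vertex)
      have "b \<notin> set (?h a)"
        using component_step[OF a, of b] b ab' by (auto simp: set_del_vertex)
      then have "a \<in> set (tree_complement g T b)"
        using ab' sym by (auto simp: set_edge_lists set_tree_complement)
      moreover have bC: "b \<in> ?C" using component_step[OF subsetD[OF AC a] ab'(3)] .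
      ultimately have "(b, a) \<in> (set F \<union> (set F)\<inverse>)\<^sup>*" using conn by blast
      moreover have "(b, y) \<in> (set F \<union> (set F)\<inverse>)\<^sup>* \<Longrightarrow> y \<in> ?C - ?A - {v}" for y
      proof (induction rule: rtrancl_induct)
        case base
        then show ?case using b bC ab' by auto
      next
        case (step x y)
        then have x: "x \<in> ?C" "x \<notin> ?A" "x \<noteq> v" by auto
        have xy: "y \<in> set (?h x)" using step by (auto simp: set_edge_lists)
        have "y \<notin> ?A"
        proof
          assume "y \<in> ?A"
          moreover have "x \<in> set (del_vertex v ?h y)"
            using hsym[OF xy] x(3) vA \<open>y \<in> ?A\<close> by (auto simp: set_del_vertex)
          ultimately have "x \<in> ?A" by (rule component_step)
          then show False using x by simp
        qed
        moreover have "y \<noteq> v"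
        proof
          assume yv: "y = v"
          have nT: "(v, x) \<notin> set T" using step(2) Fsub yv by (auto simp: set_tree_complement)
          have xv: "x \<in> set (g v)" using hg[OF xy] sym yv by blast
          obtain p where p: "(v, p) \<in> (set T)\<^sup>*" "(p, x) \<in> set T"
            using desc[OF x] by (meson tranclD2)
          have "p \<noteq> v" using p nT by auto
          then have "f v < f p" using p fdesc by (metis rtranclD)
          moreover have "v \<in> ?C" using component_step[OF x(1) hg[OF xy]] yv by simp
          then have "f p \<le> f v" using f p(2) xv C(1) by blast
          ultimately show False by simp
        qed
        moreover have "y \<in> ?C" using component_step[OF x(1) hg[OF xy]] .
        ultimately show ?case by auto
      qed
      ultimately show False using a by blast
    qed
  qed
qed

lemma select_mandatory_iff:
  assumes "select_mandatory h In k us = (M, t, s)" "distinct In" "set us \<inter> set In = {}" "0 < k"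
    "\<forall>u \<in> set us. finite (component (del_vertex u h) (set In))"
  shows "set M = {u \<in> set us. mandatory h In k u}"
  using assms
proof (induction us arbitrary: M t s)
  case (Cons u us)
  obtain b t1 s1 where b: "mandatory_test h In k u = (b, t1, s1)" using prod_cases3 by blast
  obtain M' t2 s2 where M': "select_mandatory h In k us = (M', t2, s2)" using prod_cases3 by blast
  have "b \<longleftrightarrow> mandatory h In k u" using mandatory_test_iff[OF b] Cons.prems by auto
  moreover have "set M' = {u \<in> set us. mandatory h In k u}" using Cons.IH[OF M'] Cons.prems by auto
  moreover have "M = (if b then u # M' else M')" using Cons.prems(1) b M' by auto
  ultimately show ?case by auto
qed simp

lemma mandatory_vertices_iff:
  assumes "mandatory_vertices n g In k = (M, t, s)" "\<forall>x y. y \<in> set (g x) \<longrightarrow> x \<in> set (g y)"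
    "distinct In" "In \<noteq> []" "0 < k"
    "finite (component g (set In))" "card (component g (set In)) \<le> n"
  shows "set M = {v \<in> component g (set In) - set In. mandatory g In k v}"
proof -
  obtain T t1 where T: "bfs g n In (set In) = (T, t1)" by fastforce
  obtain F t2 where F: "forest n (tree_complement g T) (In @ map snd T) {} = (F, t2)" by fastforce
  let ?h = "edge_lists (T @ F)"
  obtain M' t3 s3 where M': "select_mandatory ?h In k (map snd T) = (M', t3, s3)"
    using prod_cases3 by blast
  have M: "M = M'" using assms(1) T F M' by (auto simp: mandatory_vertices_def Let_def)
  note pr = bfs_facts[OF T]
  note C = bfs_component[OF T assms(3,4,6,7)]
  have same: "component (del_vertex v ?h) (set In) = component (del_vertex v g) (set In)"
    if "v \<in> snd ` set T" for v
    using certificate_component[OF assms(2) T assms(3,4,6,7) F, of v] that pr(2) by blast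
  have "component (del_vertex v g) (set In) \<subseteq> component g (set In)" for v
  proof (rule component_closed[OF component_base])
    fix x y assume x: "x \<in> component g (set In)" and "y \<in> set (del_vertex v g x)"
    then have "y \<in> set (g x)" by (simp add: set_del_vertex)
    then show "y \<in> component g (set In)" by (rule component_step[OF x])
  qed
  then have "finite (component (del_vertex v g) (set In))" for v
    using assms(6) by (meson finite_subset)
  then have "set M' = {u \<in> snd ` set T. mandatory ?h In k u}"
    using select_mandatory_iff[OF M' assms(3) _ assms(5)] pr(2) same by auto
  moreover have "mandatory ?h In k u = mandatory g In k u" if "u \<in> snd ` set T" for u
    using same[OF that] by (simp add: mandatory_def)
  moreover have "snd ` set T = component g (set In) - set In" using C(1) pr(2) by auto
  ultimately show ?thesis using M by auto
qed

lemma mandatory_add: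
  assumes "x \<in> set In" "u \<in> set (g x)" "u \<noteq> v" "v \<notin> set In"
  shows "mandatory g (In @ [u]) k v \<longleftrightarrow> mandatory g In k v"
proof -
  have x: "x \<in> component (del_vertex v g) (set In)"
    using assms(1) component_base by (rule subsetD[rotated])
  have "u \<in> set (del_vertex v g x)" using assms by (auto simp: set_del_vertex)
  then have u: "u \<in> component (del_vertex v g) (set In)" by (rule component_step[OF x])
  have "component (del_vertex v g) (set (In @ [u])) = component (del_vertex v g) (set In)"
  proof
    show "component (del_vertex v g) (set (In @ [u])) \<subseteq> component (del_vertex v g) (set In)"
    proof (rule component_closed)
      show "set (In @ [u]) \<subseteq> component (del_vertex v g) (set In)"
        using u component_base[of "set In"] by auto
    qed (rule component_step)
    show "component (del_vertex v g) (set In) \<subseteq> component (del_vertex v g) (set (In @ [u]))"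
      by (auto simp: component_def)
  qed
  then show ?thesis by (simp add: mandatory_def)
qed

end

theory Submission
  imports Defs
begin

text \<open>
  Let \<open>N\<close> be the number of \<open>k\<close>-graphlets containing \<open>In\<close> in the current graph. A call branches on a
  non-mandatory vertex, so both branches have a graphlet, the two families are disjoint, and the
  recursion tree has fewer than \<open>2N\<close> nodes. A node costs \<open>O(k\<^sup>2)\<close>, because a search that has seen fewer
  than \<open>k\<close> vertices inspects \<open>O(k)\<close> cells of each list, except for the deletion of the vertex \<open>z\<close>. Each
  neighbour of \<open>z\<close> lies in a graphlet containing \<open>In \<union> {z}\<close>, so the degree of \<open>z\<close> is at most \<open>k\<close> times
  the number of these graphlets; since \<open>|In|\<close> grows on that branch, each graphlet is charged \<open>k\<close> at
  most \<open>k\<close> times. If two vertices of \<open>N(In)\<close> are mandatory, each vertex of the component of \<open>In\<close> is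
  reached without one of them, so the component has fewer than \<open>2k\<close> vertices and every node of
  LIN-ENUM-V costs \<open>O(k\<^sup>2)\<close>. For the space, each call decides at least one vertex of the component,
  which bounds the recursion stack.
\<close>

section \<open>Running times of scans and searches in terms of marks, degrees and closed
  sets\<close>

section \<open>Costs of the elementary routines\<close>

text \<open>\<open>take t xs\<close> is the inspected prefix. Each of its cells is already marked or
  newly output, so for a duplicate-free list the cost is limited by the number of marks and outputs
  rather than by the degree.\<close>

lemma scan_time:
  assumes "scan Z r xs = (ys, t)"
  shows "t \<le> length xs" "set (take t xs) \<subseteq> Z \<union> set ys"
  using assms
  by (induction Z r xs arbitrary: ys t rule: scan.induct)
     (fastforce split: if_splits prod.splits)+

text \<open>Within one duplicate-free list the prefix uses at most \<open>card W\<close> cells; the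
  induction passes what is left of \<open>t\<close> to the next list.\<close>

lemma length_take_concat_le:
  assumes "\<And>x. distinct (g x)" "finite W" "set (take t (concat (map g F))) \<subseteq> W"
  shows "length (take t (concat (map g F))) \<le> length F * card W"
  using assms(3)
proof (induction F arbitrary: t)
  case (Cons x F)
  have "length (take t (g x)) = card (set (take t (g x)))"
    using assms(1) by (metis distinct_card distinct_take)
  also have "\<dots> \<le> card W" using Cons.prems assms(2) by (intro card_mono) auto
  finally show ?case using Cons.IH[of "t - length (g x)"] Cons.prems by simp
qed simp

lemma scan_concat_time:
  assumes "scan Z r (concat (map g F)) = (ys, t)" "\<And>x. distinct (g x)" "finite Z"
  shows "t \<le> length F * (card Z + length ys)"
proof -
  note st = scan_time[OF assms(1)]
  have "t = length (take t (concat (map g F)))" using st(1) by simp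
  also have "\<dots> \<le> length F * card (Z \<union> set ys)"
    using length_take_concat_le[OF assms(2) _ st(2)] assms(3) by simp
  also have "\<dots> \<le> length F * (card Z + length ys)"
    by (intro mult_le_mono2 order.trans[OF card_Un_le] add_left_mono card_length)
  finally show ?thesis .
qed

lemma neighbours_props:
  assumes "neighbours g In F r = (ws, t)"
  shows "distinct ws" "length ws \<le> r" "\<And>w. w \<in> set ws \<Longrightarrow> w \<notin> set In \<and> (\<exists>x \<in> set F. w \<in> set (g x))"
  using assms scan_props[of "set In" r "concat (map g F)"]
  by (auto simp: neighbours_def split: prod.splits)

lemma neighbours_time:
  assumes "neighbours g In F r = (ws, t)" "\<And>x. distinct (g x)"
  shows "t \<le> length F * (length In + r + 1)"
proof -
  obtain t' where t': "scan (set In) r (concat (map g F)) = (ws, t')" "t = length F + t'"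
    using assms(1) by (auto simp: neighbours_def split: prod.splits)
  have "t' \<le> length F * (card (set In) + length ws)"
    using scan_concat_time[OF t'(1) assms(2)] by simp
  also have "\<dots> \<le> length F * (length In + r)"
    using scan_props(3)[OF t'(1)] card_length[of In] by (intro mult_le_mono2 add_mono)
  finally show ?thesis using t'(2) by simp
qed

text \<open>The time bound involves the number of vertices found, so that at a leaf of the recursion
  it can be charged to the graphlets output there.\<close>

lemma all_neighbours_props:
  assumes "all_neighbours g In = (us, t)" "\<And>x. distinct (g x)"
  shows "distinct us" "\<And>u. u \<in> set us \<Longrightarrow> u \<notin> set In \<and> (\<exists>x \<in> set In. u \<in> set (g x))"
    "t \<le> length In * (length In + length us + 1)"
proof -
  let ?xs = "concat (map g In)"
  note nb = assms(1)[unfolded all_neighbours_def]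
  show "distinct us" "\<And>u. u \<in> set us \<Longrightarrow> u \<notin> set In \<and> (\<exists>x \<in> set In. u \<in> set (g x))"
    using neighbours_props[OF nb] by blast+
  obtain t' where t': "scan (set In) (length ?xs) ?xs = (us, t')" "t = length In + t'"
    using nb by (auto simp: neighbours_def split: prod.splits)
  have "t' \<le> length In * (card (set In) + length us)"
    using scan_concat_time[OF t'(1) assms(2)] by simp
  also have "\<dots> \<le> length In * (length In + length us)"
    using card_length[of In] by (intro mult_le_mono2 add_mono) auto
  finally show "t \<le> length In * (length In + length us + 1)" using t'(2) by simp
qed

text \<open>At most \<open>length q + r\<close> lists are scanned, each over at most
  \<open>card Z + r\<close> cells. Finding a vertex moves it from the budget \<open>r\<close> to the
  marks and to the queue, which increases neither number.\<close>

lemma bfs_time_square: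
  assumes "bfs g r q Z = (es, t)" "\<And>x. distinct (g x)" "finite Z"
  shows "t \<le> 1 + (length q + r) * (1 + card Z + r)"
  using assms
proof (induction g r q Z arbitrary: es t rule: bfs.induct)
  case (2 g r u q Z)
  show ?case
  proof (cases "r = 0")
    case True
    then show ?thesis using 2 by auto
  next
    case False
    obtain ws t1 where ws: "scan Z r (g u) = (ws, t1)" by fastforce
    obtain es' t2 where es': "bfs g (r - length ws) (q @ ws) (Z \<union> set ws) = (es', t2)" by fastforce
    have t: "t = 1 + t1 + t2" using 2(2) False ws es' by simp
    have lw: "length ws \<le> r" using scan_props(3)[OF ws] .
    have cZ: "card (Z \<union> set ws) + (r - length ws) \<le> card Z + r"
      using card_Un_le[of Z "set ws"] card_length[of ws] lw by linarith
    have "t1 \<le> card Z + length ws"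
      using scan_concat_time[of Z r g "[u]" ws t1] ws 2(3,4) by simp
    then have t1: "1 + t1 \<le> 1 + card Z + r" using lw by simp
    have "t2 \<le> 1 + (length (q @ ws) + (r - length ws)) * (1 + card (Z \<union> set ws) + (r - length ws))"
      using 2(1)[OF False ws[symmetric] refl es'] 2(3,4) by simp
    also have "\<dots> \<le> 1 + (length q + r) * (1 + card Z + r)"
      using cZ lw by (intro add_left_mono mult_le_mono) auto
    finally show ?thesis using t1 t by simp
  qed
qed simp

text \<open>The list of each queued vertex is traversed at most once. This is the bound for sparse
  graphs such as the certificate of \<open>mandatory_vertices\<close>, where the quadratic bound
  would be too weak.\<close>

lemma bfs_time_degrees:
  assumes "bfs g r q Z = (es, t)"
  shows "t \<le> 1 + (\<Sum>x\<leftarrow>q @ map snd es. 1 + length (g x))"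
  using assms
proof (induction g r q Z arbitrary: es t rule: bfs.induct)
  case (2 g r u q Z)
  show ?case
  proof (cases "r = 0")
    case True
    then show ?thesis using 2 by auto
  next
    case False
    obtain ws t1 where ws: "scan Z r (g u) = (ws, t1)" by fastforce
    obtain es' t2 where es': "bfs g (r - length ws) (q @ ws) (Z \<union> set ws) = (es', t2)" by fastforce
    have t: "t = 1 + t1 + t2" "es = map (Pair u) ws @ es'" using 2(2) False ws es' by auto
    have "t2 \<le> 1 + (\<Sum>x\<leftarrow>(q @ ws) @ map snd es'. 1 + length (g x))"
      using 2(1)[OF False ws[symmetric] refl es'] .
    then show ?thesis using t scan_time(1)[OF ws] by (simp add: comp_def)
  qed
qed simp

lemma bfs_closed:
  assumes "bfs g r q Z = (es, t)" "set q \<subseteq> D" "\<And>x. x \<in> D \<Longrightarrow> set (g x) \<subseteq> D"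
  shows "snd ` set es \<subseteq> D"
proof
  fix y assume "y \<in> snd ` set es"
  then obtain x where x: "x \<in> set q" "(x, y) \<in> (set es)\<^sup>*" using bfs_facts(6)[OF assms(1)] by blast
  from x(2) show "y \<in> D"
    by (induction rule: rtrancl_induct) (use x(1) assms(2,3) bfs_facts(4)[OF assms(1)] in blast)+
qed

text \<open>The vertices visited from one root are marked afterwards, so the rounds use disjoint
  parts of \<open>D - Z\<close> and their degree sums add up. A round visits one vertex more than it
  adds edges. The two units per vertex of \<open>us\<close> are the loop iteration and the last step
  of its search.\<close>

lemma forest_time:
  assumes "forest n g us Z = (fs, t)" "set us \<subseteq> D" "\<And>x. x \<in> D \<Longrightarrow> set (g x) \<subseteq> D" "finite D"
  shows "length fs \<le> card (D - Z)"
    "t \<le> 1 + 2 * length us + (\<Sum>x\<in>D - Z. 1 + length (g x))"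
proof -
  have "length fs \<le> card (D - Z) \<and> t \<le> 1 + 2 * length us + (\<Sum>x\<in>D - Z. 1 + length (g x))"
    using assms
  proof (induction n g us Z arbitrary: fs t rule: forest.induct)
    case (2 n g u us Z)
    show ?case
    proof (cases "u \<in> Z")
      case True
      then obtain t' where t': "forest n g us Z = (fs, t')" "t = 1 + t'"
        using 2(3) by (auto split: prod.splits)
      then show ?thesis using 2(1)[OF True t'(1) _ 2(5,6)] 2(4) by simp
    next
      case False
      obtain es t1 where es: "bfs g n [u] (insert u Z) = (es, t1)" by fastforce
      let ?W = "insert u (snd ` set es)"
      obtain fs' t2 where fs': "forest n g us (insert u Z \<union> snd ` set es) = (fs', t2)" by fastforce
      have fs: "fs = es @ fs'" "t = 1 + t1 + t2" using 2(3) False es fs' by auto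
      have D': "D - (insert u Z \<union> snd ` set es) = (D - Z) - ?W" by blast
      have IH: "length fs' \<le> card ((D - Z) - ?W)"
        "t2 \<le> 1 + 2 * length us + (\<Sum>x\<in>(D - Z) - ?W. 1 + length (g x))"
        using 2(2)[OF False es[symmetric] refl fs' _ 2(5,6)] 2(4) unfolding D' by auto
      note pr = bfs_facts[OF es]
      have "snd ` set es \<subseteq> D" using bfs_closed[OF es _ 2(5)] 2(4) by simp
      then have W: "?W \<subseteq> D - Z" using pr(2) 2(4) False by auto
      have dist: "distinct (u # map snd es)" using pr(1,2) by auto
      have cW: "card ?W = Suc (length es)" using distinct_card[OF dist] by simp
      have "(\<Sum>x\<leftarrow>[u] @ map snd es. 1 + length (g x)) = (\<Sum>x\<in>?W. 1 + length (g x))"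
        using sum_list_distinct_conv_sum_set[OF dist, of "\<lambda>x. 1 + length (g x)"] by simp
      then have t1: "t1 \<le> 1 + (\<Sum>x\<in>?W. 1 + length (g x))" using bfs_time_degrees[OF es] by simp
      have "card (D - Z) = card ((D - Z) - ?W) + card ?W"
        using W 2(6) by (metis card_Diff_subset card_mono finite_Diff finite_subset le_add_diff_inverse2)
      moreover have "(\<Sum>x\<in>D - Z. 1 + length (g x)) =
          (\<Sum>x\<in>(D - Z) - ?W. 1 + length (g x)) + (\<Sum>x\<in>?W. 1 + length (g x))"
        using W 2(6) by (intro sum.subset_diff) auto
      ultimately show ?thesis using IH t1 cW unfolding fs by simp
    qed
  qed simp
  then show "length fs \<le> card (D - Z)"
    "t \<le> 1 + 2 * length us + (\<Sum>x\<in>D - Z. 1 + length (g x))" by auto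
qed

lemma sum_length_edge_lists:
  assumes "finite X"
  shows "(\<Sum>x\<in>X. length (edge_lists es x)) \<le> 2 * length es"
proof (induction es)
  case (Cons e es)
  have "(\<Sum>x\<in>X. length (edge_lists (e # es) x)) =
    (\<Sum>x\<in>X. (if fst e = x then 1 else 0) + (if snd e = x then 1 else 0) + length (edge_lists es x))"
    by (intro sum.cong) (auto simp: edge_lists_def)
  also have "\<dots> = (\<Sum>x\<in>X. if fst e = x then 1 else 0) + (\<Sum>x\<in>X. if snd e = x then 1 else 0) +
      (\<Sum>x\<in>X. length (edge_lists es x))"
    by (simp add: sum.distrib)
  also have "\<dots> \<le> 1 + 1 + 2 * length es"
    using assms Cons.IH by (intro add_mono) (auto simp: sum.delta')
  finally show ?case by simp
qed (simp add: edge_lists_def)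

section \<open>Connected sets, their completions to graphlets, and counting under branching\<close>

section \<open>Connected sets grown from a root\<close>

text \<open>Connected vertex sets containing \<open>v\<close>, presented by a growth order so that
  induction replaces reasoning about paths. \<open>y\<close> may already belong to \<open>U\<close>;
  the step then changes nothing.\<close>

inductive grown :: "'v adj \<Rightarrow> 'v \<Rightarrow> 'v set \<Rightarrow> bool" for g v where
  root: "grown g v {v}"
| step: "\<lbrakk>grown g v U; x \<in> U; y \<in> set (g x)\<rbrakk> \<Longrightarrow> grown g v (insert y U)"

text \<open>For a symmetric \<open>g\<close> these are the \<open>k\<close>-graphlets through
  \<open>v\<close> that contain \<open>A\<close>; their number is the quantity to which the running
  time is charged.\<close>

definition completions :: "'v adj \<Rightarrow> 'v \<Rightarrow> nat \<Rightarrow> 'v set \<Rightarrow> 'v set set" where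
  "completions g v k A = {U. grown g v U \<and> A \<subseteq> U \<and> card U = k}"

text \<open>\<open>V\<close> stays the vertex set of the input: a deleted vertex survives as an
  isolated vertex with an empty list, so deletions keep this property for the same
  \<open>V\<close>.\<close>

definition wf_adj :: "'v set \<Rightarrow> 'v adj \<Rightarrow> bool" where
  "wf_adj V g \<longleftrightarrow> finite V \<and> (\<forall>x. distinct (g x) \<and> set (g x) \<subseteq> V) \<and>
     (\<forall>x y. y \<in> set (g x) \<longrightarrow> x \<in> set (g y))"

lemma wf_adjD:
  assumes "wf_adj V g"
  shows "finite V" "\<And>x. distinct (g x)" "\<And>x. set (g x) \<subseteq> V"
    "\<forall>x y. y \<in> set (g x) \<longrightarrow> x \<in> set (g y)"
  using assms by (auto simp: wf_adj_def)

lemma wf_adj_del_vertex: "wf_adj V g \<Longrightarrow> wf_adj V (del_vertex z g)"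
  by (auto simp: wf_adj_def set_del_vertex) (auto simp: del_vertex_def distinct_removeAll)

lemma grown_root: "grown g v U \<Longrightarrow> v \<in> U"
  by (induction rule: grown.induct) auto

lemma grown_finite: "grown g v U \<Longrightarrow> finite U"
  by (induction rule: grown.induct) auto

lemma grown_subset: "\<lbrakk>grown g v U; v \<in> V; \<And>x. set (g x) \<subseteq> V\<rbrakk> \<Longrightarrow> U \<subseteq> V"
  by (induction rule: grown.induct) auto

lemma grown_union: "\<lbrakk>grown g v U; x \<in> U; set ws \<subseteq> set (g x)\<rbrakk> \<Longrightarrow> grown g v (U \<union> set ws)"
  by (induction ws) (auto intro: grown.step)

lemma grown_bfs:
  assumes "bfs g r q Z = (es, t)" "grown g v U" "set q \<subseteq> U"
  shows "grown g v (U \<union> snd ` set es)"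
  using assms
proof (induction g r q Z arbitrary: es t U rule: bfs.induct)
  case (2 g r u q Z)
  show ?case
  proof (cases "r = 0")
    case True
    then show ?thesis using 2 by auto
  next
    case False
    obtain ws t1 where ws: "scan Z r (g u) = (ws, t1)" by fastforce
    obtain es' t2 where es': "bfs g (r - length ws) (q @ ws) (Z \<union> set ws) = (es', t2)" by fastforce
    have es: "es = map (Pair u) ws @ es'" using 2(2) False ws es' by auto
    have "grown g v (U \<union> set ws)"
      using grown_union[OF 2(3), of u ws] 2(4) scan_props(2)[OF ws] by auto
    then have "grown g v ((U \<union> set ws) \<union> snd ` set es')"
      using 2(1)[OF False ws[symmetric] refl es'] 2(4) by auto
    moreover have "(U \<union> set ws) \<union> snd ` set es' = U \<union> snd ` set es" unfolding es by force
    ultimately show ?thesis by simp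
  qed
qed simp

lemma grown_del_vertex: "\<lbrakk>grown g v U; z \<notin> U\<rbrakk> \<Longrightarrow> grown (del_vertex z g) v U"
  by (induction rule: grown.induct) (auto intro: grown.intros simp: set_del_vertex)

text \<open>\<open>z \<noteq> v\<close> excludes the root: \<open>{v}\<close> is grown in every
  graph, even after the deletion of \<open>v\<close>.\<close>

lemma grown_del_vertexD:
  assumes "grown (del_vertex z g) v U" "z \<noteq> v"
  shows "grown g v U" "z \<notin> U"
  using assms by (induction rule: grown.induct) (auto intro: grown.intros simp: set_del_vertex)

lemma finite_completions:
  assumes "wf_adj V g" "v \<in> V"
  shows "finite (completions g v k A)"
proof (rule finite_subset)
  show "completions g v k A \<subseteq> Pow V"
    using grown_subset[of g v _ V] assms(2) wf_adjD(3)[OF assms(1)] by (auto simp: completions_def)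
qed (use wf_adjD(1)[OF assms(1)] in simp)

lemma component_mono: "A \<subseteq> B \<Longrightarrow> component g A \<subseteq> component g B"
  by (auto simp: component_def)

lemma component_idem_subset: "B \<subseteq> component g A \<Longrightarrow> component g B \<subseteq> component g A"
  by (rule component_closed) (auto intro: component_step)

lemma component_subset: "\<lbrakk>A \<subseteq> V; \<And>x. set (g x) \<subseteq> V\<rbrakk> \<Longrightarrow> component g A \<subseteq> V"
  by (rule component_closed) auto

lemma component_del_vertex: "component (del_vertex z g) A \<subseteq> component g A"
  by (rule component_closed[OF component_base]) (auto simp: set_del_vertex intro: component_step)

lemma component_del_vertex_notin: "z \<notin> A \<Longrightarrow> z \<notin> component (del_vertex z g) A"
  using component_closed[of A "- {z}" "del_vertex z g"] by (auto simp: set_del_vertex)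

text \<open>Greedy growth: a set smaller than its component is not closed, so some neighbour can be
  added, and this leaves the component unchanged. Adding one vertex at a time hits the size
  \<open>k\<close> exactly.\<close>

lemma completions_nonempty:
  assumes "grown g v A" "card A \<le> k" "k \<le> card (component g A)"
  shows "completions g v k A \<noteq> {}"
  using assms
proof (induction "k - card A" arbitrary: A)
  case 0
  then show ?case by (auto simp: completions_def)
next
  case (Suc m)
  have fin: "finite A" using grown_finite[OF Suc.prems(1)] .
  have "\<not> component g A \<subseteq> A" using Suc card_mono[OF fin, of "component g A"] by linarith
  then obtain x y where xy: "x \<in> A" "y \<in> set (g x)" "y \<notin> A"
    using component_closed[of A A g] by blast
  have gr: "grown g v (insert y A)" using grown.step[OF Suc.prems(1) xy(1,2)] .
  have "insert y A \<subseteq> component g A"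
    using component_step[of x g A y] component_base[of A g] xy by blast
  then have "component g (insert y A) = component g A"
    using component_mono[of A "insert y A" g] component_idem_subset by blast
  then have "completions g v k (insert y A) \<noteq> {}"
    using Suc.hyps(1)[of "insert y A"] gr Suc.hyps(2) Suc.prems xy(3) fin by simp
  then show ?case by (auto simp: completions_def)
qed

text \<open>The two families are separated by membership of \<open>z\<close>. Allowing
  \<open>A \<subseteq> B\<close> absorbs the vertices that a loop adds before the branch.\<close>

lemma completions_branch:
  assumes "wf_adj V g" "v \<in> V" "z \<noteq> v" "A \<subseteq> B"
  shows "card (completions g v k (insert z B)) + card (completions (del_vertex z g) v k B)
    \<le> card (completions g v k A)"
proof -
  let ?X = "completions g v k (insert z B)" and ?Y = "completions (del_vertex z g) v k B"
  have "?X \<inter> ?Y = {}" using grown_del_vertexD(2)[OF _ assms(3)] by (auto simp: completions_def)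
  moreover have "finite ?X" "finite ?Y"
    by (rule finite_completions[OF assms(1,2)])
       (rule finite_completions[OF wf_adj_del_vertex[OF assms(1)] assms(2)])
  ultimately have "card ?X + card ?Y = card (?X \<union> ?Y)" by (simp add: card_Un_disjoint)
  also have "\<dots> \<le> card (completions g v k A)"
    using assms(4) grown_del_vertexD(1)[OF _ assms(3)]
    by (intro card_mono finite_completions[OF assms(1,2)]) (auto simp: completions_def)
  finally show ?thesis .
qed

text \<open>Since \<open>insert z A\<close> has fewer than \<open>k\<close> vertices, there is room
  for any neighbour \<open>w\<close> of \<open>z\<close>, and the enlarged set can be completed. So
  the completions, of \<open>k\<close> vertices each, cover the neighbourhood of
  \<open>z\<close>.\<close>

lemma degree_le_completions:
  assumes "wf_adj V g" "v \<in> V" "grown g v (insert z A)" "card (insert z A) < k"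
    "k \<le> card (component g (insert z A))"
  shows "length (g z) \<le> k * card (completions g v k (insert z A))"
proof -
  let ?S = "completions g v k (insert z A)"
  have "set (g z) \<subseteq> \<Union>?S"
  proof
    fix w assume w: "w \<in> set (g z)"
    let ?B = "insert w (insert z A)"
    have gr: "grown g v ?B" using grown.step[OF assms(3) _ w] by simp
    have "?B \<subseteq> component g (insert z A)"
      using component_step[of z g "insert z A" w] component_base[of "insert z A" g] w by blast
    then have "component g ?B = component g (insert z A)"
      using component_mono[of "insert z A" ?B g] component_idem_subset by blast
    moreover have "card ?B \<le> k"
      using assms(4) card_insert_if[of "insert z A" w] grown_finite[OF gr] by auto
    ultimately have "completions g v k ?B \<noteq> {}"
      using completions_nonempty[OF gr] assms(5) by simp
    then show "w \<in> \<Union>?S" by (auto simp: completions_def)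
  qed
  moreover have fin: "finite ?S" by (rule finite_completions[OF assms(1,2)])
  moreover have "finite (\<Union>?S)"
    using fin grown_finite by (intro finite_Union) (auto simp: completions_def)
  ultimately have "card (set (g z)) \<le> card (\<Union>?S)" by (intro card_mono)
  also have "\<dots> \<le> (\<Sum>U\<in>?S. card U)" by (rule card_Union_le_sum_card)
  also have "\<dots> = k * card ?S" by (simp add: completions_def)
  finally show ?thesis using wf_adjD(2)[OF assms(1)] by (simp add: distinct_card)
qed

section \<open>One mandatory test, and all tests on the sparse certificate\<close>

section \<open>Costs of the tests for mandatory vertices\<close>

lemma bfs_bounds_closed:
  assumes "bfs g r q Z = (es, t)" "distinct q" "set q \<inter> snd ` set es = {}"
    "set q \<subseteq> D" "\<And>x. x \<in> D \<Longrightarrow> set (g x) \<subseteq> D" "finite D"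
  shows "length q + length es \<le> card D" "t \<le> 1 + (\<Sum>x\<in>D. 1 + length (g x))"
proof -
  have dist: "distinct (q @ map snd es)" using assms(2,3) bfs_facts(1)[OF assms(1)] by auto
  have sub: "set (q @ map snd es) \<subseteq> D" using bfs_closed[OF assms(1,4,5)] assms(4) by auto
  show "length q + length es \<le> card D"
    using card_mono[OF assms(6) sub] distinct_card[OF dist] by simp
  have "t \<le> 1 + (\<Sum>x\<leftarrow>q @ map snd es. 1 + length (g x))" by (rule bfs_time_degrees[OF assms(1)])
  also have "(\<Sum>x\<leftarrow>q @ map snd es. 1 + length (g x)) = (\<Sum>x\<in>set (q @ map snd es). 1 + length (g x))"
    by (rule sum_list_distinct_conv_sum_set[OF dist])
  also have "\<dots> \<le> (\<Sum>x\<in>D. 1 + length (g x))" by (rule sum_mono2[OF assms(6) sub]) simp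
  finally show "t \<le> 1 + (\<Sum>x\<in>D. 1 + length (g x))" by simp
qed

lemma mandatory_test_time_square:
  assumes "mandatory_test g In k z = (b, t, s)" "\<And>x. distinct (g x)" "length In \<le> k"
  shows "t \<le> k + 1 + k * (k + 2)"
proof -
  obtain es t' where es: "bfs g (k - length In) In (insert z (set In)) = (es, t')" by fastforce
  have "t' \<le> 1 + (length In + (k - length In)) * (1 + card (insert z (set In)) + (k - length In))"
    using bfs_time_square[OF es assms(2)] by simp
  \<comment> \<open>The marks are \<open>In\<close> and \<open>z\<close>, and
    \<open>length In\<close> cancels: the first factor is \<open>k\<close>, the second at most
    \<open>1 + (length In + 1) + (k - length In)\<close>.\<close>
  also have "\<dots> \<le> 1 + k * (k + 2)"
    using assms(3) card_length[of In] card_insert_le_m1[of "Suc (length In)" "set In" z]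
    by (intro add_left_mono mult_le_mono) auto
  finally show ?thesis using assms(1,3) es by (auto simp: mandatory_test_def)
qed

lemma mandatory_test_bounds_closed:
  assumes "mandatory_test g In k z = (b, t, s)" "distinct In"
    "set In \<subseteq> D" "\<And>x. x \<in> D \<Longrightarrow> set (g x) \<subseteq> D" "finite D"
  shows "s \<le> card D" "t \<le> length In + 1 + (\<Sum>x\<in>D. 1 + length (g x))"
proof -
  obtain es t' where es: "bfs g (k - length In) In (insert z (set In)) = (es, t')" by fastforce
  have "set In \<inter> snd ` set es = {}" using bfs_facts(2)[OF es] by blast
  from bfs_bounds_closed[OF es assms(2) this assms(3-5)]
  show "s \<le> card D" "t \<le> length In + 1 + (\<Sum>x\<in>D. 1 + length (g x))"
    using assms(1) es by (auto simp: mandatory_test_def)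
qed

lemma select_mandatory_bounds:
  assumes "select_mandatory h In k us = (M, t, s)"
    "\<And>u b t s. mandatory_test h In k u = (b, t, s) \<Longrightarrow> t \<le> a \<and> s \<le> d"
  shows "length M \<le> length us" "t \<le> 1 + length us * (1 + a)" "s \<le> d"
proof -
  have "length M \<le> length us \<and> t \<le> 1 + length us * (1 + a) \<and> s \<le> d"
    using assms(1)
  proof (induction us arbitrary: M t s)
    case (Cons u us)
    obtain b t1 s1 where b: "mandatory_test h In k u = (b, t1, s1)" using prod_cases3 by blast
    obtain M' t2 s2 where M': "select_mandatory h In k us = (M', t2, s2)" using prod_cases3 by blast
    show ?case using Cons.prems b M' Cons.IH[OF M'] assms(2)[OF b] by auto
  qed auto
  then show "length M \<le> length us" "t \<le> 1 + length us * (1 + a)" "s \<le> d" by auto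
qed

text \<open>The tree, the traversal of the lists and the forest each pay the degree sum
  \<open>w\<close> once. The at most \<open>c\<close> tests run on the certificate, whose size is
  linear in \<open>c\<close>; they give the term \<open>6 * (c * c)\<close>.\<close>

lemma mandatory_vertices_bounds:
  assumes "mandatory_vertices n g In k = (M, t, s)" "\<forall>x y. y \<in> set (g x) \<longrightarrow> x \<in> set (g y)"
    "distinct In" "In \<noteq> []" "finite (component g (set In))" "card (component g (set In)) \<le> n"
  defines "c \<equiv> card (component g (set In))"
    and "w \<equiv> (\<Sum>x\<in>component g (set In). 1 + length (g x))"
  shows "length M \<le> c" "t \<le> 3 + 3 * w + 10 * c + 6 * (c * c)" "s \<le> 10 * c + w"
proof -
  let ?C = "component g (set In)"
  obtain T t1 where T: "bfs g n In (set In) = (T, t1)" by fastforce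
  obtain F t2 where F: "forest n (tree_complement g T) (In @ map snd T) {} = (F, t2)" by fastforce
  let ?h = "edge_lists (T @ F)"
  obtain M' t3 s3 where M': "select_mandatory ?h In k (map snd T) = (M', t3, s3)"
    using prod_cases3 by blast
  note pr = bfs_facts[OF T]
  note C = bfs_component[OF T assms(3-6)]
  have cl: "set (g x) \<subseteq> ?C" if "x \<in> ?C" for x using component_step[OF that] by blast
  have disj: "set In \<inter> snd ` set T = {}" using pr(2) by blast
  have T': "length In + length T \<le> c" "t1 \<le> 1 + w"
    using bfs_bounds_closed[OF T assms(3) disj component_base cl assms(5)] by (auto simp: c_def w_def)
  have dist: "distinct (In @ map snd T)" using assms(3) disj pr(1) by auto
  have setC: "set (In @ map snd T) = ?C" using C(1) by simp
  have lenC: "length (In @ map snd T) = c" using distinct_card[OF dist] setC by (simp add: c_def)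
  have sizeC: "(\<Sum>u\<leftarrow>In @ map snd T. 1 + length (g u)) = w"
    using sum_list_distinct_conv_sum_set[OF dist, of "\<lambda>x. 1 + length (g x)"] setC
    by (simp add: w_def)
  have clT: "set (tree_complement g T x) \<subseteq> ?C" if "x \<in> ?C" for x
    using cl[OF that] by (auto simp: set_tree_complement)
  note fb = forest_time[OF F equalityD1[OF setC] clT assms(5)]
  have lF: "length F \<le> c" using fb(1) by (simp add: c_def)
  have "t2 \<le> 1 + 2 * length (In @ map snd T) + (\<Sum>x\<in>?C. 1 + length (tree_complement g T x))"
    using fb(2) by simp
  also have "(\<Sum>x\<in>?C. 1 + length (tree_complement g T x)) \<le> w"
    unfolding w_def tree_complement_def by (intro sum_mono add_left_mono length_filter_le)
  finally have t2: "t2 \<le> 1 + 2 * c + w" using lenC by simp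
  \<comment> \<open>Every certificate edge is an edge of \<open>g\<close>, so the component in
    \<open>g\<close> is closed under the certificate as well.\<close>
  have clh: "set (?h x) \<subseteq> ?C" if x: "x \<in> ?C" for x
  proof
    fix y assume "y \<in> set (?h x)"
    then have "(x, y) \<in> set T \<union> set F \<or> (y, x) \<in> set T \<union> set F" by (auto simp: set_edge_lists)
    moreover have "b \<in> set (g a)" if "(a, b) \<in> set T \<union> set F" for a b
      using that pr(4) forest_props(1)[OF F] by (auto simp: set_tree_complement)
    ultimately have "y \<in> set (g x)" using assms(2) by blast
    then show "y \<in> ?C" using cl[OF x] by blast
  qed
  \<comment> \<open>There are \<open>c\<close> list heads, and two cells for each of the at most
    \<open>2 * c\<close> edges of \<open>T @ F\<close>.\<close>
  have wh: "(\<Sum>x\<in>?C. 1 + length (?h x)) \<le> 5 * c"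
    using sum_length_edge_lists[OF assms(5), of "T @ F"] T' lF unfolding sum.distrib
    by (simp add: c_def)
  \<comment> \<open>One test costs \<open>length In \<le> c\<close>, the constant 1, and the
    certificate size \<open>5 * c\<close>.\<close>
  have sel: "t \<le> 6 * c + 1 \<and> s \<le> c" if "mandatory_test ?h In k u = (b, t, s)" for u b t s
    using mandatory_test_bounds_closed[OF that assms(3) component_base clh assms(5)] wh T'(1)
    unfolding c_def by linarith
  have sm: "length M' \<le> length (map snd T)" "t3 \<le> 1 + length (map snd T) * (1 + (6 * c + 1))" "s3 \<le> c"
    by (rule select_mandatory_bounds[OF M', of "6 * c + 1" c]; erule sel)+
  have "t3 \<le> 1 + length (map snd T) * (1 + (6 * c + 1))" by (rule sm(2))
  also have "\<dots> \<le> 1 + c * (1 + (6 * c + 1))" using T'(1) by (intro add_left_mono mult_le_mono1) simp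
  also have "\<dots> = 1 + 2 * c + 6 * (c * c)" by (simp add: algebra_simps)
  finally have t3: "t3 \<le> 1 + 2 * c + 6 * (c * c)" .
  have eqs: "M = M'"
    "t = length In + t1 + w + t2 + (c + 2 * (length T + length F)) + t3"
    "s = c + w + (length T + length F) + (c + 2 * (length T + length F)) + length M + s3"
    using assms(1) T F M' lenC sizeC by (auto simp: mandatory_vertices_def Let_def)
  show "length M \<le> c" using sm(1) eqs(1) T'(1) by simp
  then show "s \<le> 10 * c + w" using eqs(3) T'(1) lF sm(3) by simp
  show "t \<le> 3 + 3 * w + 10 * c + 6 * (c * c)" using eqs(2) T' lF t2 t3 by simp
qed

section \<open>Invariant and measure shared by both recursions\<close>

section \<open>Recursive calls\<close>

text \<open>Invariant of both recursions. The root \<open>v\<close> is fixed throughout: it lies in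
  \<open>In\<close>, and only vertices outside \<open>In\<close> are deleted.\<close>

definition state :: "'v set \<Rightarrow> 'v \<Rightarrow> 'v adj \<Rightarrow> 'v list \<Rightarrow> bool" where
  "state V v g In \<longleftrightarrow> wf_adj V g \<and> v \<in> V \<and> distinct In \<and> grown g v (set In)"

text \<open>Measure of both recursions: the reachable vertices neither added nor deleted so far. It
  yields termination and pays for the recursion stack.\<close>

definition undecided :: "'v adj \<Rightarrow> 'v list \<Rightarrow> 'v set" where
  "undecided g In = component g (set In) - set In"

lemma stateD:
  assumes "state V v g In"
  shows "wf_adj V g" "v \<in> V" "distinct In" "grown g v (set In)" "v \<in> set In" "In \<noteq> []"
    "set In \<subseteq> V" "component g (set In) \<subseteq> V" "finite (component g (set In))"
    "card (component g (set In)) \<le> card V"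
proof -
  show *: "wf_adj V g" "v \<in> V" "distinct In" "grown g v (set In)"
    using assms by (auto simp: state_def)
  show "v \<in> set In" using grown_root[OF *(4)] .
  then show "In \<noteq> []" by auto
  show V: "set In \<subseteq> V" using grown_subset[OF *(4,2)] wf_adjD(3)[OF *(1)] by blast
  show C: "component g (set In) \<subseteq> V" using component_subset[OF V] wf_adjD(3)[OF *(1)] by blast
  show "finite (component g (set In))" "card (component g (set In)) \<le> card V"
    by (rule finite_subset[OF C wf_adjD(1)[OF *(1)]]) (rule card_mono[OF wf_adjD(1)[OF *(1)] C])
qed

lemma state_add:
  assumes "state V v g In" "x \<in> set In" "z \<in> set (g x)" "z \<notin> set In"
  shows "state V v g (In @ [z])"
  using assms grown.step[of g v "set In" x z] by (auto simp: state_def)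

lemma state_delete:
  assumes "state V v g In" "z \<notin> set In"
  shows "state V v (del_vertex z g) In"
  using assms grown_del_vertex[of g v "set In" z] wf_adj_del_vertex[of V g z] by (auto simp: state_def)

text \<open>The vertices added by the loop leave the undecided set, and so does \<open>z\<close> in
  either branch, because it enters \<open>In\<close> or becomes unreachable. The drop is
  proportional to the words of the stack frame.\<close>

lemma undecided_branch:
  assumes "state V v g In" "state V v g In'" "set In \<subseteq> set In'" "set In' \<subseteq> component g (set In)"
    "x \<in> set In'" "z \<in> set (g x)" "z \<notin> set In'"
  shows "card (undecided g (In' @ [z])) + (length In' - length In) + 1 \<le> card (undecided g In)"
    "card (undecided (del_vertex z g) In') + (length In' - length In) + 1 \<le> card (undecided g In)"
proof -
  have z: "z \<in> component g (set In)" using component_step[OF subsetD[OF assms(4,5)] assms(6)] .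
  have fin: "finite (undecided g In)" using stateD(9)[OF assms(1)] by (simp add: undecided_def)
  let ?X = "insert z (set In' - set In)"
  have X: "?X \<subseteq> undecided g In" using z assms(3,4,7) by (auto simp: undecided_def)
  have cX: "card ?X = (length In' - length In) + 1"
    using assms(3,7) stateD(3)[OF assms(1)] stateD(3)[OF assms(2)]
    by (simp add: card_Diff_subset distinct_card)
  have *: "card Y + (length In' - length In) + 1 \<le> card (undecided g In)"
    if Y: "Y \<subseteq> undecided g In - ?X" for Y
  proof -
    have "card Y \<le> card (undecided g In - ?X)" using Y fin by (intro card_mono) auto
    also have "\<dots> = card (undecided g In) - card ?X" using X fin by (intro card_Diff_subset) auto
    finally show ?thesis using cX card_mono[OF fin X] by linarith
  qed
  have "component g (set (In' @ [z])) \<subseteq> component g (set In)"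
    by (rule component_idem_subset) (use assms(4) z in auto)
  then show "card (undecided g (In' @ [z])) + (length In' - length In) + 1 \<le> card (undecided g In)"
    using assms(3) by (intro *) (auto simp: undecided_def)
  have "component (del_vertex z g) (set In') \<subseteq> component g (set In)"
    using component_del_vertex[of z g "set In'"] component_idem_subset[OF assms(4)] by blast
  moreover have "z \<notin> component (del_vertex z g) (set In')"
    by (rule component_del_vertex_notin[OF assms(7)])
  ultimately show "card (undecided (del_vertex z g) In') + (length In' - length In) + 1
      \<le> card (undecided g In)"
    using assms(3) by (intro *) (auto simp: undecided_def)
qed

lemma undecided_added:
  assumes "state V v g In" "state V v g In'" "set In \<subseteq> set In'" "set In' \<subseteq> component g (set In)"
  shows "length In' - length In \<le> card (undecided g In)"
proof -
  have "card (set In' - set In) \<le> card (undecided g In)"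
    using assms(4) stateD(9)[OF assms(1)] by (intro card_mono) (auto simp: undecided_def)
  then show ?thesis
    using assms(3) stateD(3)[OF assms(1)] stateD(3)[OF assms(2)]
    by (simp add: card_Diff_subset distinct_card)
qed

text \<open>If \<open>k\<close> vertices stay reachable without \<open>z\<close>, a graphlet
  avoiding \<open>z\<close> exists; the component is no smaller when \<open>z\<close> is added to
  \<open>In\<close>, so a graphlet containing \<open>z\<close> exists too. No branch is a dead
  end.\<close>

lemma nonmandatory_branch:
  assumes "state V v g In" "x \<in> set In" "z \<in> set (g x)" "z \<notin> set In" "length In < k"
    "k \<le> card (component (del_vertex z g) (set In))"
  shows "1 \<le> card (completions g v k (set (In @ [z])))"
    "1 \<le> card (completions (del_vertex z g) v k (set In))"
    "k \<le> card (component g (set (In @ [z])))"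
proof -
  note S1 = state_add[OF assms(1-4)]
  note S2 = state_delete[OF assms(1,4)]
  have "component (del_vertex z g) (set In) \<subseteq> component g (set (In @ [z]))"
    using component_del_vertex[of z g "set In"] component_mono[of "set In" "set (In @ [z])" g] by auto
  then show C: "k \<le> card (component g (set (In @ [z])))"
    using card_mono[OF stateD(9)[OF S1]] assms(6) by (meson order.trans)
  have "completions g v k (set (In @ [z])) \<noteq> {}"
    by (rule completions_nonempty[OF stateD(4)[OF S1] _ C])
       (use distinct_card[OF stateD(3)[OF S1]] assms(5) in simp)
  then show "1 \<le> card (completions g v k (set (In @ [z])))"
    using finite_completions[OF stateD(1,2)[OF S1]] by (simp add: Suc_le_eq card_gt_0_iff)
  have "completions (del_vertex z g) v k (set In) \<noteq> {}"
    by (rule completions_nonempty[OF stateD(4)[OF S2] _ assms(6)])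
       (use distinct_card[OF stateD(3)[OF S2]] assms(5) in simp)
  then show "1 \<le> card (completions (del_vertex z g) v k (set In))"
    using finite_completions[OF stateD(1,2)[OF S2]] by (simp add: Suc_le_eq card_gt_0_iff)
qed

section \<open>LIN-ENUM-V: termination, space, and time on components of at most 2k vertices\<close>

section \<open>LIN-ENUM-V\<close>

lemma add_mandatory_props:
  assumes "add_mandatory n g In k = (In', t, s)" "state V v g In" "card V \<le> n" "0 < k"
    "length In \<le> k"
  defines "c \<equiv> card (component g (set In))"
    and "w \<equiv> (\<Sum>x\<in>component g (set In). 1 + length (g x))"
  shows "state V v g In'" "set In \<subseteq> set In'" "set In' \<subseteq> component g (set In)"
    "length In \<le> length In'" "length In' \<le> k"
    "\<And>x z. \<lbrakk>length In' \<noteq> k; x \<in> set In'; z \<in> set (g x); z \<notin> set In'\<rbrakk>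
      \<Longrightarrow> k \<le> card (component (del_vertex z g) (set In'))"
    "t \<le> 4 + 4 * w + 12 * c + 6 * (c * c)" "s \<le> 11 * c + w"
proof -
  let ?C = "component g (set In)"
  note S = stateD[OF assms(2)]
  obtain M t1 s1 where M: "mandatory_vertices n g In k = (M, t1, s1)" using prod_cases3 by blast
  obtain es t2 where es: "bfs g (k - length In) In (- set M) = (es, t2)" by fastforce
  have In': "In' = In @ map snd es" "t = t1 + length M + length In + t2"
      "s = s1 + length In + length es"
    using assms(1) M es by (auto simp: add_mandatory_def)
  note cn = order.trans[OF S(10) assms(3)]
  note mb = mandatory_vertices_bounds[OF M wf_adjD(4)[OF S(1)] S(3,6,9) cn]
  have setM: "set M = {v \<in> ?C - set In. mandatory g In k v}"
    by (rule mandatory_vertices_iff[OF M wf_adjD(4)[OF S(1)] S(3,6) assms(4) S(9) cn])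
  note pr = bfs_facts[OF es]
  \<comment> \<open>\<open>M\<close> avoids \<open>In\<close>, so the marks \<open>- set M\<close>
    include \<open>In\<close> and the search never finds it again.\<close>
  have disj: "set In \<inter> snd ` set es = {}" using pr(2) setM by blast
  have cl: "set (g x) \<subseteq> ?C" if "x \<in> ?C" for x using component_step[OF that] by blast
  note bb = bfs_bounds_closed[OF es S(3) disj component_base cl S(9)]
  show "set In \<subseteq> set In'" "length In \<le> length In'" using In'(1) by auto
  show sub: "set In' \<subseteq> ?C"
    using bfs_closed[OF es component_base cl] component_base[of "set In" g] In'(1) by auto
  show "state V v g In'"
    using S grown_bfs[OF es S(4)] disj pr(1) In'(1) by (auto simp: state_def)
  show len: "length In' \<le> k" using pr(3) In'(1) assms(5) by simp
  show "k \<le> card (component (del_vertex z g) (set In'))"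
    if z: "length In' \<noteq> k" "x \<in> set In'" "z \<in> set (g x)" "z \<notin> set In'" for x z
  proof -
    \<comment> \<open>A search that ends below its limit has scanned every list of
      \<open>In'\<close> completely, so a neighbour \<open>z\<close> that was not added is outside
      \<open>M\<close>.\<close>
    have "length es < k - length In" using z(1) len In'(1) by simp
    then have "set (g x) \<subseteq> - set M \<union> snd ` set es" using pr(7) z(2) In'(1) by auto
    then have "z \<notin> set M" using z(3,4) In'(1) by auto
    moreover have "z \<in> ?C" using cl sub z(2,3) by blast
    ultimately have "\<not> mandatory g In k z" using setM z(4) In'(1) by auto
    then have "k \<le> card (component (del_vertex z g) (set In))" by (simp add: mandatory_def)
    \<comment> \<open>Being non-mandatory for the old \<open>In\<close> suffices: starting from more
      vertices reaches no fewer.\<close>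
    also have "\<dots> \<le> card (component (del_vertex z g) (set In'))"
    proof (rule card_mono)
      show "finite (component (del_vertex z g) (set In'))"
        by (rule stateD(9)[OF state_delete[OF \<open>state V v g In'\<close> z(4)]])
    qed (use In'(1) in \<open>auto intro: component_mono[THEN subsetD]\<close>)
    finally show ?thesis .
  qed
  show "t \<le> 4 + 4 * w + 12 * c + 6 * (c * c)" "s \<le> 11 * c + w"
    using mb bb In'(2,3) unfolding c_def w_def by simp_all
qed

lemma neighbours_one_cases:
  obtains t where "neighbours g In F 1 = ([], t)" | z t where "neighbours g In F 1 = ([z], t)"
proof -
  obtain ws t where ws: "neighbours g In F 1 = (ws, t)" by fastforce
  then have "length ws \<le> 1" by (rule neighbours_props(2))
  then consider "ws = []" | z where "ws = [z]" by (cases ws) auto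
  then show ?thesis using ws that by cases auto
qed

text \<open>A derivation is a terminating run. The rules cover all outcomes of the loop and the
  neighbour search, and both recursive calls have a smaller undecided set.\<close>

lemma lin_enum_v_exists:
  assumes "state V v g In" "card V \<le> n" "0 < k" "length In \<le> k"
  shows "\<exists>out t s. lin_enum_v n k g In out t s"
  using assms(1,4)
proof (induction "card (undecided g In)" arbitrary: g In rule: less_induct)
  case less
  show ?case
  proof (cases "length In = k")
    case True
    then show ?thesis by (blast intro: lin_full)
  next
    case False
    obtain In' t0 s0 where am: "add_mandatory n g In k = (In', t0, s0)" using prod_cases3 by blast
    note A = add_mandatory_props[OF am less.prems(1) assms(2,3) less.prems(2)]
    show ?thesis
    proof (cases "length In' = k")
      case True
      then show ?thesis using lin_filled[OF False am refl] by blast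
    next
      case F: False
      show ?thesis
      proof (cases rule: neighbours_one_cases[of g In' In'])
        case (1 t)
        then show ?thesis using lin_stuck[OF False am refl F] by blast
      next
        case (2 z t)
        then obtain x where x: "x \<in> set In'" "z \<in> set (g x)" "z \<notin> set In'"
          using neighbours_props(3)[OF 2, of z] by auto
        note U = undecided_branch[OF less.prems(1) A(1-3) x]
        obtain o2 t2 s2 where "lin_enum_v n k g (In' @ [z]) o2 t2 s2"
          using less.hyps[OF _ state_add[OF A(1) x]] U(1) F A(5) by auto
        moreover obtain o3 t3 s3 where "lin_enum_v n k (del_vertex z g) In' o3 t3 s3"
          using less.hyps[OF _ state_delete[OF A(1) x(3)]] U(2) A(5) by auto
        ultimately show ?thesis using lin_branch[OF False am refl F 2] by blast
      qed
    qed
  qed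
qed

lemma sum_degrees_square:
  assumes "state V v g In"
  shows "(\<Sum>x\<in>component g (set In). 1 + length (g x)) \<le>
    card (component g (set In)) + card (component g (set In)) * card (component g (set In))"
proof -
  let ?C = "component g (set In)"
  have "length (g x) \<le> card ?C" if "x \<in> ?C" for x
    using card_mono[OF stateD(9)[OF assms], of "set (g x)"] component_step[OF that]
      wf_adjD(2)[OF stateD(1)[OF assms]] by (metis distinct_card subsetI)
  then have "(\<Sum>x\<in>?C. 1 + length (g x)) \<le> (\<Sum>x\<in>?C. 1 + card ?C)" by (intro sum_mono) auto
  then show ?thesis by simp
qed

lemma sum_degrees_del_vertex:
  "(\<Sum>x\<in>V. 1 + length (del_vertex z g x)) \<le> (\<Sum>x\<in>V. 1 + length (g x))"
  by (intro sum_mono) (simp add: del_vertex_def)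

lemma add_mandatory_space:
  assumes "add_mandatory n g In k = (In', t, s)" "state V v g In" "card V \<le> n" "0 < k"
    "length In \<le> k"
  shows "s \<le> 12 * (\<Sum>x\<in>V. 1 + length (g x))"
proof -
  let ?C = "component g (set In)"
  have "card ?C = (\<Sum>x\<in>?C. 1)" by simp
  also have "\<dots> \<le> (\<Sum>x\<in>?C. 1 + length (g x))" by (rule sum_mono) simp
  finally have 1: "card ?C \<le> (\<Sum>x\<in>?C. 1 + length (g x))" .
  have 2: "(\<Sum>x\<in>?C. 1 + length (g x)) \<le> (\<Sum>x\<in>V. 1 + length (g x))"
    using stateD(8)[OF assms(2)] wf_adjD(1)[OF stateD(1)[OF assms(2)]] by (intro sum_mono2) auto
  \<comment> \<open>The factor 12 collects \<open>11 * c\<close> and \<open>w\<close>, both bounded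
    by the total size of the lists.\<close>
  show ?thesis using add_mandatory_props(8)[OF assms] 1 2 by simp
qed

text \<open>Working storage is shared by all levels through a maximum, so \<open>12 * L\<close> is
  counted once, and \<open>L\<close> remains valid because deletions only shrink lists. A level adds
  at most \<open>3 + a\<close> words, covered by four times the drop \<open>a + 1\<close> of the
  measure.\<close>

lemma lin_enum_v_space:
  assumes "lin_enum_v n k g In out t s" "state V v g In" "card V \<le> n" "0 < k" "length In \<le> k"
    "(\<Sum>x\<in>V. 1 + length (g x)) \<le> L"
  shows "s \<le> 2 + 4 * card (undecided g In) + 12 * L"
  using assms(1,2,5,6)
proof (induction rule: lin_enum_v.induct)
  case (lin_full In g)
  then show ?case by simp
next
  case (lin_filled In g In' t0 s0 a)
  note A = add_mandatory_props[OF lin_filled(2,5) assms(3,4) lin_filled(6)]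
  have "s0 \<le> 12 * L"
    using add_mandatory_space[OF lin_filled(2,5) assms(3,4) lin_filled(6)] lin_filled(7) by simp
  then show ?case
    using undecided_added[OF lin_filled(5) A(1-3)] lin_filled(3) by simp
next
  case (lin_branch In g In' t0 s0 a z t1 out2 t2 s2 out3 t3 s3)
  note prems = lin_branch(10-12)
  note A = add_mandatory_props[OF lin_branch(2) prems(1) assms(3,4) prems(2)]
  have s0: "s0 \<le> 12 * L"
    using add_mandatory_space[OF lin_branch(2) prems(1) assms(3,4) prems(2)] prems(3) by simp
  obtain x where x: "x \<in> set In'" "z \<in> set (g x)" "z \<notin> set In'"
    using neighbours_props(3)[OF lin_branch(5), of z] by auto
  note U = undecided_branch[OF prems(1) A(1-3) x]
  have "s2 \<le> 2 + 4 * card (undecided g (In' @ [z])) + 12 * L"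
    using lin_branch.IH(1)[OF state_add[OF A(1) x] _ prems(3)] lin_branch(4) A(5) by simp
  moreover have "s3 \<le> 2 + 4 * card (undecided (del_vertex z g) In') + 12 * L"
    using lin_branch.IH(2)[OF state_delete[OF A(1) x(3)] A(5)
      order.trans[OF sum_degrees_del_vertex prems(3)]] .
  ultimately show ?case using U s0 lin_branch(3) by simp
next
  case (lin_stuck In g In' t0 s0 a t1)
  note A = add_mandatory_props[OF lin_stuck(2,6) assms(3,4) lin_stuck(7)]
  have "s0 \<le> 12 * L"
    using add_mandatory_space[OF lin_stuck(2,6) assms(3,4) lin_stuck(7)] lin_stuck(8) by simp
  then show ?case
    using undecided_added[OF lin_stuck(6) A(1-3)] lin_stuck(3) by simp
qed

lemma add_mandatory_time:
  assumes "add_mandatory n g In k = (In', t, s)" "state V v g In" "card V \<le> n" "0 < k"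
    "length In \<le> k" "card (component g (set In)) \<le> 2 * k"
  shows "t \<le> 120 * k\<^sup>2"
proof -
  define c where "c = card (component g (set In))"
  have "v \<in> component g (set In)" using stateD(5)[OF assms(2)] component_base by fast
  then have "1 \<le> c" using stateD(9)[OF assms(2)] unfolding c_def by (metis One_nat_def Suc_leI card_gt_0_iff empty_iff)
  then have 1: "1 \<le> c * c" "c \<le> c * c" by simp_all
  have "c * c \<le> (2 * k) * (2 * k)" using assms(6) unfolding c_def by (intro mult_le_mono)
  then have 2: "c * c \<le> 4 * k\<^sup>2" by (simp add: power2_eq_square)
  \<comment> \<open>The degree sum is at most \<open>c + c * c\<close>. With
    \<open>1 \<le> c \<le> 2 * k\<close> the total is at most
    \<open>30 * (c * c) \<le> 120 * k\<^sup>2\<close>.\<close>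
  have "t \<le> 4 + 16 * c + 10 * (c * c)"
    using add_mandatory_props(7)[OF assms(1-5)] sum_degrees_square[OF assms(2)]
    unfolding c_def[symmetric] by simp
  then show ?thesis using 1 2 by linarith
qed

lemma le_square_nat: "k \<le> k\<^sup>2" for k :: nat
  by (cases k) (auto simp: power2_eq_square)

lemma neighbours_one_time:
  assumes "neighbours g In In 1 = (ws, t)" "state V v g In" "length In \<le> k"
  shows "t \<le> 3 * k\<^sup>2"
proof -
  have "t \<le> length In * (length In + 1 + 1)"
    using neighbours_time[OF assms(1)] wf_adjD(2)[OF stateD(1)[OF assms(2)]] by blast
  also have "\<dots> \<le> k * (k + 1 + 1)" using assms(3) by (intro mult_le_mono) auto
  also have "\<dots> = k\<^sup>2 + 2 * k" by (simp add: power2_eq_square)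
  finally show ?thesis using le_square_nat[of k] by linarith
qed

text \<open>A binary recursion tree with at most \<open>N\<close> leaves, in potential form: two
  children leave credits of \<open>200 * k\<^sup>2\<close> each, of which one pays for the node and
  one is passed on. \<open>max 1\<close> covers calls for which no graphlet is exhibited.\<close>

lemma lin_enum_v_time:
  assumes "lin_enum_v n k g In out t s" "state V v g In" "card V \<le> n" "0 < k" "length In \<le> k"
    "card (component g (set In)) \<le> 2 * k"
  shows "t + 200 * k\<^sup>2 \<le> 400 * (k\<^sup>2 * max 1 (card (completions g v k (set In))))"
  using assms(1,2,5,6)
proof (induction rule: lin_enum_v.induct)
  have q: "1 \<le> k\<^sup>2" "k \<le> k\<^sup>2" using assms(4) le_square_nat[of k] by simp_all
  have M: "k\<^sup>2 \<le> k\<^sup>2 * max 1 N" for N :: nat by simp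
  {
    case (lin_full In g)
    show ?case using q M[of "card (completions g v k (set In))"] by linarith
  next
    case (lin_filled In g In' t0 s0 a)
    have "t0 \<le> 120 * k\<^sup>2"
      by (rule add_mandatory_time[OF lin_filled(2,5) assms(3,4) lin_filled(6,7)])
    moreover have "a \<le> k" using lin_filled(3,4) by simp
    ultimately show ?case using q M[of "card (completions g v k (set In))"] by linarith
  next
    case (lin_branch In g In' t0 s0 a z t1 out2 t2 s2 out3 t3 s3)
    note prems = lin_branch(10-12)
    note A = add_mandatory_props[OF lin_branch(2) prems(1) assms(3,4) prems(2)]
    have t0: "t0 \<le> 120 * k\<^sup>2"
      by (rule add_mandatory_time[OF lin_branch(2) prems(1) assms(3,4) prems(2,3)])
    have t1: "t1 \<le> 3 * k\<^sup>2" by (rule neighbours_one_time[OF lin_branch(5) A(1,5)])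
    have a: "a \<le> k" using lin_branch(3) A(5) by simp
    have len: "length In' < k" using lin_branch(4) A(5) by simp
    obtain x where x: "x \<in> set In'" "z \<in> set (g x)" "z \<notin> set In'"
      using neighbours_props(3)[OF lin_branch(5), of z] by auto
    let ?C = "component g (set In)"
    note fin = stateD(9)[OF prems(1)]
    have z: "z \<in> ?C" using component_step[OF subsetD[OF A(3) x(1)] x(2)] .
    \<comment> \<open>The neighbourhood of \<open>z\<close> lies in the small component, so a
      deletion costs only \<open>O(k)\<close> here and needs no charge to graphlets.\<close>
    have "set (g z) \<subseteq> ?C" using component_step[OF z] by blast
    then have "card (set (g z)) \<le> 2 * k" using card_mono[OF fin] prems(3) by (meson order.trans)
    then have deg: "length (g z) \<le> 2 * k"
      using wf_adjD(2)[OF stateD(1)[OF prems(1)]] by (simp add: distinct_card)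
    have "set (In' @ [z]) \<subseteq> ?C" using A(3) z by simp
    then have C2: "card (component g (set (In' @ [z]))) \<le> 2 * k"
      using card_mono[OF fin component_idem_subset] prems(3) by (meson order.trans)
    have "component (del_vertex z g) (set In') \<subseteq> ?C"
      using component_del_vertex[of z g "set In'"] component_idem_subset[OF A(3)] by blast
    then have C3: "card (component (del_vertex z g) (set In')) \<le> 2 * k"
      using card_mono[OF fin] prems(3) by (meson order.trans)
    define N1 where "N1 = card (completions g v k (set (In' @ [z])))"
    define N2 where "N2 = card (completions (del_vertex z g) v k (set In'))"
    define N where "N = card (completions g v k (set In))"
    have N12: "1 \<le> N1" "1 \<le> N2"
      using nonmandatory_branch[OF A(1) x len A(6)[OF lin_branch(4) x]] by (auto simp: N1_def N2_def)
    have "z \<noteq> v" using x(3) stateD(5)[OF A(1)] by auto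
    then have "N1 + N2 \<le> N"
      using completions_branch[OF stateD(1,2)[OF prems(1)] _ A(2), of z k]
      by (simp add: N1_def N2_def N_def)
    then have "k\<^sup>2 * (N1 + N2) \<le> k\<^sup>2 * max 1 N" by (intro mult_le_mono2) simp
    then have qN: "k\<^sup>2 * N1 + k\<^sup>2 * N2 \<le> k\<^sup>2 * max 1 N" by (simp add: algebra_simps)
    have m: "max 1 N1 = N1" "max 1 N2 = N2" using N12 by simp_all
    have "t2 + 200 * k\<^sup>2 \<le> 400 * (k\<^sup>2 * N1)"
      using lin_branch.IH(1)[OF state_add[OF A(1) x] _ C2] len m(1) by (simp add: N1_def)
    moreover have "t3 + 200 * k\<^sup>2 \<le> 400 * (k\<^sup>2 * N2)"
      using lin_branch.IH(2)[OF state_delete[OF A(1) x(3)] A(5) C3] m(2) by (simp add: N2_def)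
    ultimately show ?case
      using t0 t1 a deg qN q unfolding N_def[symmetric] update_time_def by simp
  next
    case (lin_stuck In g In' t0 s0 a t1)
    note A = add_mandatory_props[OF lin_stuck(2,6) assms(3,4) lin_stuck(7)]
    have "t0 \<le> 120 * k\<^sup>2"
      by (rule add_mandatory_time[OF lin_stuck(2,6) assms(3,4) lin_stuck(7,8)])
    moreover have "t1 \<le> 3 * k\<^sup>2" by (rule neighbours_one_time[OF lin_stuck(5) A(1,5)])
    moreover have "a \<le> k" using lin_stuck(3) A(5) by simp
    ultimately show ?case using q M[of "card (completions g v k (set In))"] by linarith
  }
qed

section \<open>ENUM-V: the extension loop, termination, space, and amortised time\<close>

section \<open>ENUM-V\<close>

text \<open>At most \<open>length F + r\<close> lists are scanned in total, as each later round only
  looks at the list of the vertex just added. The cells seen in a list lie in the current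
  \<open>In\<close> or among the two vertices sought, so a list costs at most
  \<open>length In + r + 3\<close>.\<close>

lemma extend_props:
  assumes "extend g r F In = (In', ws, t)" "state V v g In" "set F \<subseteq> set In"
  shows "state V v g In' \<and> set In \<subseteq> set In' \<and> set In' \<subseteq> component g (set In) \<and>
    length In \<le> length In' \<and> length In' \<le> length In + r \<and> distinct ws \<and>
    (\<forall>w \<in> set ws. w \<notin> set In' \<and> (\<exists>x \<in> set In'. w \<in> set (g x))) \<and>
    (length In' \<noteq> length In + r \<longrightarrow> ws = [] \<or> length ws = 2) \<and>
    t \<le> 1 + r + (length F + r) * (length In + r + 3)"
  using assms
proof (induction g r F In arbitrary: In' ws t rule: extend.induct)
  case (1 g F In)
  then show ?case using component_base[of "set In" g] by auto
next
  case (2 g r F In)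
  obtain us t1 where us: "neighbours g In F 2 = (us, t1)" by fastforce
  note np = neighbours_props[OF us]
  have t1: "t1 \<le> length F * (length In + 2 + 1)"
    using neighbours_time[OF us] wf_adjD(2)[OF stateD(1)[OF "2.prems"(2)]] by blast
  show ?case
  proof (cases "length us = 1")
    case True
    then obtain z where z: "us = [z]" by (cases us) auto
    obtain In'' ws' t' where ex: "extend g r [z] (In @ [z]) = (In'', ws', t')" using prod_cases3 by blast
    have eq: "In' = In''" "ws = ws'" "t = 1 + t1 + t'" using "2.prems"(1) us z ex by auto
    obtain x where x: "x \<in> set In" "z \<in> set (g x)" "z \<notin> set In"
      using np(3)[of z] z "2.prems"(3) by auto
    note S = state_add[OF "2.prems"(2) x]
    have IH: "state V v g In'" "set (In @ [z]) \<subseteq> set In'" "set In' \<subseteq> component g (set (In @ [z]))"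
      "length (In @ [z]) \<le> length In'" "length In' \<le> length (In @ [z]) + r" "distinct ws"
      "\<forall>w \<in> set ws. w \<notin> set In' \<and> (\<exists>x \<in> set In'. w \<in> set (g x))"
      "length In' \<noteq> length (In @ [z]) + r \<longrightarrow> ws = [] \<or> length ws = 2"
      "t' \<le> 1 + r + (length [z] + r) * (length (In @ [z]) + r + 3)"
      using "2.IH"[OF us[symmetric] refl z refl ex S] eq by auto
    have "set (In @ [z]) \<subseteq> component g (set In)"
      using component_step[of x g "set In" z] component_base[of "set In" g] x by auto
    then have "set In' \<subseteq> component g (set In)" using component_idem_subset IH(3) by blast
    moreover have "t \<le> 1 + Suc r + (length F + Suc r) * (length In + Suc r + 3)"
    proof -
      have "t1 \<le> length F * (length In + Suc r + 3)"
        by (rule order.trans[OF t1]) (intro mult_le_mono2, simp)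
      moreover have "t' \<le> 1 + r + Suc r * (length In + Suc r + 3)" using IH(9) by simp
      ultimately show ?thesis unfolding eq(3) add_mult_distrib by linarith
    qed
    ultimately show ?thesis using IH by simp
  next
    case False
    have eq: "In' = In" "ws = us" "t = 1 + t1"
      using "2.prems"(1) us False by (auto split: list.splits)
    have "length us = 2 \<or> us = []" using np(2) False by (auto simp: le_Suc_eq numeral_2_eq_2)
    moreover have "t1 \<le> length F * (length In + Suc r + 3)"
      by (rule order.trans[OF t1]) (intro mult_le_mono2, simp)
    then have "t \<le> 1 + Suc r + (length F + Suc r) * (length In + Suc r + 3)"
      unfolding eq(3) add_mult_distrib by linarith
    moreover have "\<forall>w \<in> set us. w \<notin> set In \<and> (\<exists>x \<in> set In. w \<in> set (g x))"
      using np(3) "2.prems"(3) by blast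
    ultimately show ?thesis
      using eq np(1) "2.prems"(2) component_base[of "set In" g] by auto
  qed
qed

lemma extend_call:
  assumes "extend g (k - 1 - length In) In In = (In', ws, t)" "state V v g In"
    "length In \<le> k" "length In \<noteq> k"
  shows "state V v g In'" "set In \<subseteq> set In'" "set In' \<subseteq> component g (set In)"
    "length In \<le> length In'" "length In' \<le> k - 1" "distinct ws"
    "\<And>w. w \<in> set ws \<Longrightarrow> w \<notin> set In' \<and> (\<exists>x \<in> set In'. w \<in> set (g x))"
    "length In' \<noteq> k - 1 \<Longrightarrow> ws = [] \<or> length ws = 2"
    "t \<le> 5 * k\<^sup>2"
proof -
  let ?r = "k - 1 - length In"
  have r: "length In + ?r = k - 1" using assms(3,4) by simp
  note E = extend_props[OF assms(1,2) order.refl]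
  show "state V v g In'" "set In \<subseteq> set In'" "set In' \<subseteq> component g (set In)"
    "length In \<le> length In'" "length In' \<le> k - 1" "distinct ws"
    "\<And>w. w \<in> set ws \<Longrightarrow> w \<notin> set In' \<and> (\<exists>x \<in> set In'. w \<in> set (g x))"
    "length In' \<noteq> k - 1 \<Longrightarrow> ws = [] \<or> length ws = 2"
    using E r by auto
  have k: "0 < k" using assms(3,4) by simp
  have "t \<le> 1 + ?r + (length In + ?r) * (length In + ?r + 3)" using E by blast
  also have "\<dots> \<le> 1 + k + k * (k + 2)"
    unfolding r using k by (intro add_mono[of "1 + ?r" "1 + k"] mult_le_mono) simp_all
  finally have "t \<le> 1 + k + k * (k + 2)" .
  moreover have "k * (k + 2) = k\<^sup>2 + 2 * k" by (simp add: power2_eq_square)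
  moreover have "1 \<le> k\<^sup>2" "k \<le> k\<^sup>2" using k le_square_nat[of k] by simp_all
  ultimately show "t \<le> 5 * k\<^sup>2" by linarith
qed

text \<open>Neither of the two vertices separates the other one from \<open>In\<close>.\<close>

lemma two_mandatory_component:
  assumes "state V v g In" "mandatory g In k x" "mandatory g In k y" "x \<noteq> y"
    "x \<notin> set In" "y \<notin> set In" "a \<in> set In" "x \<in> set (g a)" "b \<in> set In" "y \<in> set (g b)"
  shows "card (component g (set In)) \<le> 2 * k"
proof -
  let ?X = "component (del_vertex x g) (set In)" and ?Y = "component (del_vertex y g) (set In)"
  have x: "x \<in> ?Y"
    by (rule component_step[of a]) (use assms component_base[of "set In"] in \<open>auto simp: set_del_vertex\<close>)
  have y: "y \<in> ?X"
    by (rule component_step[of b]) (use assms component_base[of "set In"] in \<open>auto simp: set_del_vertex\<close>)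
  \<comment> \<open>An edge can leave \<open>?X\<close> only towards \<open>x\<close>, which lies in
    \<open>?Y\<close>, and vice versa, so the union is closed.\<close>
  have "component g (set In) \<subseteq> ?X \<union> ?Y"
  proof (rule component_closed)
    show "set In \<subseteq> ?X \<union> ?Y" using component_base by fast
    fix c d assume cd: "c \<in> ?X \<union> ?Y" "d \<in> set (g c)"
    have nx: "x \<notin> ?X" "y \<notin> ?Y"
      using component_del_vertex_notin[OF assms(5)] component_del_vertex_notin[OF assms(6)] by auto
    from cd(1) show "d \<in> ?X \<union> ?Y"
    proof
      assume c: "c \<in> ?X"
      then have "d = x \<or> d \<in> ?X"
        using component_step[OF c, of d] cd(2) nx by (auto simp: set_del_vertex)
      then show ?thesis using x by auto
    next
      assume c: "c \<in> ?Y"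
      then have "d = y \<or> d \<in> ?Y"
        using component_step[OF c, of d] cd(2) nx by (auto simp: set_del_vertex)
      then show ?thesis using y by auto
    qed
  qed
  moreover have "finite ?X" "finite ?Y"
    using stateD(9)[OF state_delete[OF assms(1,5)]] stateD(9)[OF state_delete[OF assms(1,6)]] .
  ultimately have "card (component g (set In)) \<le> card (?X \<union> ?Y)" by (intro card_mono) auto
  also have "\<dots> \<le> card ?X + card ?Y" by (rule card_Un_le)
  also have "\<dots> \<le> 2 * k" using assms(2,3) by (simp add: mandatory_def)
  finally show ?thesis .
qed

lemma mandatory_test_call:
  assumes "mandatory_test g In k z = (b, t, s)" "state V v g In" "length In < k" "z \<notin> set In"
  shows "b \<longleftrightarrow> mandatory g In k z" "t \<le> 5 * k\<^sup>2" "s \<le> card V"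
proof -
  note S = stateD[OF assms(2)]
  show "b \<longleftrightarrow> mandatory g In k z"
    using mandatory_test_iff[OF assms(1) S(3) assms(4)] assms(3)
      stateD(9)[OF state_delete[OF assms(2,4)]] by simp
  have "t \<le> k + 1 + k * (k + 2)"
    using mandatory_test_time_square[OF assms(1)] wf_adjD(2)[OF S(1)] assms(3) by simp
  moreover have "k * (k + 2) = k\<^sup>2 + 2 * k" by (simp add: power2_eq_square)
  moreover have "1 \<le> k\<^sup>2" "k \<le> k\<^sup>2" using assms(3) le_square_nat[of k] by simp_all
  ultimately show "t \<le> 5 * k\<^sup>2" by linarith
  show "s \<le> card V"
    by (rule mandatory_test_bounds_closed(1)[OF assms(1) S(3,7)])
       (use wf_adjD[OF S(1)] in auto)
qed

lemma enum_v_exists: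
  assumes "state V v g In" "card V \<le> n" "0 < k" "length In \<le> k"
  shows "\<exists>out t s. enum_v n k g In out t s"
  using assms(1,4)
proof (induction "card (undecided g In)" arbitrary: g In rule: less_induct)
  case less
  show ?case
  proof (cases "length In = k")
    case True
    then show ?thesis by (blast intro: enum_full)
  next
    case False
    obtain In' ws t0 where ex: "extend g (k - 1 - length In) In In = (In', ws, t0)"
      using prod_cases3 by blast
    note E = extend_call[OF ex less.prems False]
    show ?thesis
    proof (cases "length In' = k - 1")
      case True
      obtain us t1 where "all_neighbours g In' = (us, t1)" by fastforce
      from enum_leaf[OF False ex refl True this] show ?thesis by blast
    next
      case F: False
      then have len: "length In' < k" "Suc (length In') \<le> k" using E(5) by auto
      from E(8)[OF F] show ?thesis
      proof
        assume "ws = []"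
        then show ?thesis using enum_stuck[OF False ex[unfolded \<open>ws = []\<close>] refl F] by blast
      next
        assume "length ws = 2"
        then obtain x y where ws: "ws = [x, y]"
          by (metis (no_types) Suc_length_conv length_0_conv numeral_2_eq_2)
        note ex' = ex[unfolded ws]
        \<comment> \<open>Stated for either of the two vertices, so that it serves both branching
          rules.\<close>
        have branch: "\<exists>o1 t1 s1 o2 t2 s2. enum_v n k g (In' @ [z]) o1 t1 s1 \<and>
            enum_v n k (del_vertex z g) In' o2 t2 s2" if z: "z \<in> set ws" for z
        proof -
          obtain u where u: "u \<in> set In'" "z \<in> set (g u)" "z \<notin> set In'" using E(7)[OF z] by blast
          note U = undecided_branch[OF less.prems(1) E(1-3) u]
          have "\<exists>o1 t1 s1. enum_v n k g (In' @ [z]) o1 t1 s1"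
            by (rule less.hyps[OF _ state_add[OF E(1) u]]) (use U(1) len in auto)
          moreover have "\<exists>o1 t1 s1. enum_v n k (del_vertex z g) In' o1 t1 s1"
            by (rule less.hyps[OF _ state_delete[OF E(1) u(3)]]) (use U(2) len in auto)
          ultimately show ?thesis by blast
        qed
        obtain bx tx sx where tx: "mandatory_test g In' k x = (bx, tx, sx)" using prod_cases3 by blast
        obtain b' ty sy where ty: "mandatory_test g In' k y = (b', ty, sy)" using prod_cases3 by blast
        consider "bx = False" | "bx = True" "b' = False" | "bx = True" "b' = True" by blast
        then show ?thesis
        proof cases
          case 1
          have "x \<in> set ws" using ws by simp
          then show ?thesis using branch enum_branch_first[OF False ex' refl F tx[unfolded 1]] by blast
        next
          case 2
          have "y \<in> set ws" using ws by simp
          then show ?thesis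
            using branch enum_branch_second[OF False ex' refl F tx[unfolded 2(1)] ty[unfolded 2(2)]]
            by blast
        next
          case 3
          obtain o1 t1 s1 where "lin_enum_v n k g In' o1 t1 s1"
            using lin_enum_v_exists[OF E(1) assms(2,3)] len by auto
          then show ?thesis
            using enum_lin[OF False ex' refl F tx[unfolded 3(1)] ty[unfolded 3(2)]] by blast
        qed
      qed
    qed
  qed
qed

text \<open>Same accounting as in \<open>lin_enum_v_space\<close>. The additive constant is 4
  instead of 2 to pay for the frame from which LIN-ENUM-V is called.\<close>

lemma enum_v_space:
  assumes "enum_v n k g In out t s" "state V v g In" "card V \<le> n" "0 < k" "length In \<le> k"
    "(\<Sum>x\<in>V. 1 + length (g x)) \<le> L"
  shows "s \<le> 4 + 4 * card (undecided g In) + 12 * L"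
proof -
  have VL: "card V \<le> L" using assms(6) unfolding sum.distrib by simp
  show ?thesis
    using assms(1,2,5,6)
  proof (induction rule: enum_v.induct)
    case (enum_full In g)
    then show ?case by simp
  next
    case (enum_leaf In g In' ws t0 a us t1)
    note E = extend_call[OF enum_leaf(2,6,7,1)]
    note wf = wf_adjD[OF stateD(1)[OF E(1)]]
    note N = all_neighbours_props[OF enum_leaf(5) wf(2)]
    have "set us \<subseteq> V" using N(2) wf(3) by blast
    then have "length us \<le> card V" using card_mono[OF wf(1)] distinct_card[OF N(1)] by metis
    then show ?case
      using undecided_added[OF enum_leaf(6) E(1-3)] enum_leaf(3) VL by simp
  next
    case (enum_stuck In g In' t0 a)
    note E = extend_call[OF enum_stuck(2,5,6,1)]
    show ?case using undecided_added[OF enum_stuck(5) E(1-3)] enum_stuck(3) by simp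
  next
    case (enum_branch_first In g In' x y t0 a tx sx out1 t1 s1 out2 t2 s2)
    note prems = enum_branch_first(10-12)
    note E = extend_call[OF enum_branch_first(2) prems(1,2) enum_branch_first(1)]
    have len: "length In' < k" "Suc (length In') \<le> k" using E(5) enum_branch_first(4) by auto
    obtain u where u: "u \<in> set In'" "x \<in> set (g u)" "x \<notin> set In'" using E(7)[of x] by auto
    note U = undecided_branch[OF prems(1) E(1-3) u]
    have "s1 \<le> 4 + 4 * card (undecided g (In' @ [x])) + 12 * L"
      using enum_branch_first.IH(1)[OF state_add[OF E(1) u] _ prems(3)] len by simp
    moreover have "s2 \<le> 4 + 4 * card (undecided (del_vertex x g) In') + 12 * L"
      using enum_branch_first.IH(2)[OF state_delete[OF E(1) u(3)] _
        order.trans[OF sum_degrees_del_vertex prems(3)]] len by simp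
    moreover have "sx \<le> L"
      using mandatory_test_call(3)[OF enum_branch_first(5) E(1) len(1) u(3)] VL by simp
    ultimately show ?case using U enum_branch_first(3) by simp
  next
    case (enum_branch_second In g In' x y t0 a tx sx ty sy out1 t1 s1 out2 t2 s2)
    note prems = enum_branch_second(11-13)
    note E = extend_call[OF enum_branch_second(2) prems(1,2) enum_branch_second(1)]
    have len: "length In' < k" "Suc (length In') \<le> k" using E(5) enum_branch_second(4) by auto
    obtain u where u: "u \<in> set In'" "y \<in> set (g u)" "y \<notin> set In'" using E(7)[of y] by auto
    have x: "x \<notin> set In'" using E(7)[of x] by auto
    note U = undecided_branch[OF prems(1) E(1-3) u]
    have "s1 \<le> 4 + 4 * card (undecided g (In' @ [y])) + 12 * L"
      using enum_branch_second.IH(1)[OF state_add[OF E(1) u] _ prems(3)] len by simp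
    moreover have "s2 \<le> 4 + 4 * card (undecided (del_vertex y g) In') + 12 * L"
      using enum_branch_second.IH(2)[OF state_delete[OF E(1) u(3)] _
        order.trans[OF sum_degrees_del_vertex prems(3)]] len by simp
    moreover have "sx \<le> L" "sy \<le> L"
      using mandatory_test_call(3)[OF enum_branch_second(5) E(1) len(1) x]
        mandatory_test_call(3)[OF enum_branch_second(6) E(1) len(1) u(3)] VL by simp_all
    ultimately show ?case using U enum_branch_second(3) by simp
  next
    case (enum_lin In g In' x y t0 a tx sx ty sy out1 t1 s1)
    note prems = enum_lin(8-10)
    note E = extend_call[OF enum_lin(2) prems(1,2) enum_lin(1)]
    have len: "length In' < k" "Suc (length In') \<le> k" using E(5) enum_lin(4) by auto
    have xy: "x \<notin> set In'" "y \<notin> set In'" using E(7)[of x] E(7)[of y] by auto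
    have "s1 \<le> 2 + 4 * card (undecided g In') + 12 * L"
      using lin_enum_v_space[OF enum_lin(7) E(1) assms(3,4) _ prems(3)] len by simp
    moreover have "sx \<le> L" "sy \<le> L"
      using mandatory_test_call(3)[OF enum_lin(5) E(1) len(1) xy(1)]
        mandatory_test_call(3)[OF enum_lin(6) E(1) len(1) xy(2)] VL by simp_all
    \<comment> \<open>The switch to LIN-ENUM-V decides no vertex beyond those added by the loop, so
      the drop may be zero.\<close>
    moreover have "card (undecided g In') + (length In' - length In) \<le> card (undecided g In)"
    proof -
      have "undecided g In' \<subseteq> undecided g In - (set In' - set In)"
        using component_idem_subset[OF E(3)] E(2) by (auto simp: undecided_def)
      moreover have fin: "finite (undecided g In)"
        using stateD(9)[OF prems(1)] by (simp add: undecided_def)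
      ultimately have "card (undecided g In') \<le> card (undecided g In - (set In' - set In))"
        by (intro card_mono) auto
      also have "\<dots> = card (undecided g In) - card (set In' - set In)"
        using E(3) fin by (intro card_Diff_subset) (auto simp: undecided_def)
      also have "card (set In' - set In) = length In' - length In"
        using E(2) stateD(3)[OF prems(1)] stateD(3)[OF E(1)]
        by (simp add: card_Diff_subset distinct_card)
      finally show ?thesis using undecided_added[OF prems(1) E(1-3)] by simp
    qed
    ultimately show ?case using enum_lin(3) by simp
  qed
qed

text \<open>The sets output at a leaf are pairwise different completions; they pay for the scan and
  for the output.\<close>

lemma length_le_completions:
  assumes "state V v g In" "set A \<subseteq> set In" "length In = k - 1" "0 < k" "distinct us"
    "\<And>u. u \<in> set us \<Longrightarrow> u \<notin> set In \<and> (\<exists>x \<in> set In. u \<in> set (g x))"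
  shows "length us \<le> card (completions g v k (set A))"
proof -
  note S = stateD[OF assms(1)]
  have "inj_on (\<lambda>u. insert u (set In)) (set us)"
  proof (rule inj_onI)
    fix x y assume xy: "x \<in> set us" "y \<in> set us" "insert x (set In) = insert y (set In)"
    then have "x \<in> insert y (set In)" by blast
    then show "x = y" using assms(6)[OF xy(1)] by simp
  qed
  then have "card ((\<lambda>u. insert u (set In)) ` set us) = length us"
    using distinct_card[OF assms(5)] by (simp add: card_image)
  moreover have "(\<lambda>u. insert u (set In)) ` set us \<subseteq> completions g v k (set A)"
  proof
    fix U assume "U \<in> (\<lambda>u. insert u (set In)) ` set us"
    then obtain u where u: "u \<in> set us" "U = insert u (set In)" by blast
    obtain x where x: "x \<in> set In" "u \<in> set (g x)" "u \<notin> set In" using assms(6)[OF u(1)] by blast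
    have "grown g v U" using grown.step[OF S(4) x(1,2)] u(2) by simp
    moreover have "card U = k" using u(2) x(3) distinct_card[OF S(3)] assms(3,4) by simp
    ultimately show "U \<in> completions g v k (set A)" using assms(2) u(2) by (auto simp: completions_def)
  qed
  ultimately show ?thesis using card_mono[OF finite_completions[OF S(1,2)]] by metis
qed

text \<open>
  Deleting \<open>z\<close> costs up to \<open>k\<close> time units per completion containing \<open>z\<close>. A completion pays this
  only when \<open>z\<close> is added to \<open>In\<close>, so at most \<open>k - |In|\<close> times: this is the second summand of the
  potential.
\<close>

lemma enum_branch_time:
  assumes "state V v g In" "state V v g In'" "set In \<subseteq> set In'" "length In \<le> length In'"
    "length In' < k - 1" "x \<in> set In'" "z \<in> set (g x)" "z \<notin> set In'"
    "k \<le> card (component (del_vertex z g) (set In'))"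
    "t1 + 300 * k\<^sup>2 \<le> 600 * (k\<^sup>2 * max 1 (card (completions g v k (set (In' @ [z]))))) +
      2 * (k * (k - length (In' @ [z])) * max 1 (card (completions g v k (set (In' @ [z])))))"
    "t2 + 300 * k\<^sup>2 \<le> 600 * (k\<^sup>2 * max 1 (card (completions (del_vertex z g) v k (set In')))) +
      2 * (k * (k - length In') * max 1 (card (completions (del_vertex z g) v k (set In'))))"
    "t0 \<le> 25 * k\<^sup>2"
  shows "t0 + t1 + update_time g z + t2 + 300 * k\<^sup>2 \<le>
    600 * (k\<^sup>2 * max 1 (card (completions g v k (set In)))) +
    2 * (k * (k - length In) * max 1 (card (completions g v k (set In))))"
proof -
  define N1 where "N1 = card (completions g v k (set (In' @ [z])))"
  define N2 where "N2 = card (completions (del_vertex z g) v k (set In'))"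
  define N where "N = max 1 (card (completions g v k (set In)))"
  have len: "length In' < k" using assms(5) by simp
  note nb = nonmandatory_branch[OF assms(2,6-8) len assms(9)]
  have N12: "1 \<le> N1" "1 \<le> N2" using nb by (auto simp: N1_def N2_def)
  have zv: "z \<noteq> v" using assms(8) stateD(5)[OF assms(2)] by auto
  note S = state_add[OF assms(2,6-8)]
  have "card (completions g v k (insert z (set In'))) +
      card (completions (del_vertex z g) v k (set In')) \<le> card (completions g v k (set In))"
    by (rule completions_branch[OF stateD(1,2)[OF assms(1)] zv assms(3)])
  then have NN: "N1 + N2 \<le> N" by (simp add: N1_def N2_def N_def)
  have ins: "set (In' @ [z]) = insert z (set In')" by simp
  \<comment> \<open>\<open>length In' < k - 1\<close> leaves room for a neighbour of
    \<open>z\<close>, as the degree bound requires.\<close>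
  have "card (insert z (set In')) < k"
    using distinct_card[OF stateD(3)[OF S]] assms(5) by simp
  then have deg: "length (g z) \<le> k * N1"
    using degree_le_completions[OF stateD(1,2)[OF S] stateD(4)[OF S, unfolded ins]] nb(3)
    unfolding N1_def ins by blast
  have q: "1 \<le> k\<^sup>2" using assms(5) by simp
  have qN: "k\<^sup>2 * N1 + k\<^sup>2 * N2 \<le> k\<^sup>2 * N"
    using mult_le_mono2[OF NN, of "k\<^sup>2"] by (simp add: algebra_simps)
  let ?d = "k - length In"
  \<comment> \<open>Adding \<open>z\<close> brings \<open>In\<close> at least one vertex closer to
    \<open>k\<close>, which frees \<open>k * N1\<close> in the second summand for the deletion of
    \<open>z\<close>.\<close>
  have "k * (k - length (In' @ [z])) * N1 + k * N1 = k * (k - length (In' @ [z]) + 1) * N1"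
    by (simp add: algebra_simps)
  also have "\<dots> \<le> k * ?d * N1" using assms(4) len by (intro mult_le_mono) auto
  finally have d1: "k * (k - length (In' @ [z])) * N1 + k * N1 \<le> k * ?d * N1" .
  have d2: "k * (k - length In') * N2 \<le> k * ?d * N2" using assms(4) by (intro mult_le_mono) auto
  have dN: "k * ?d * N1 + k * ?d * N2 \<le> k * ?d * N"
    using mult_le_mono2[OF NN, of "k * ?d"] by (simp only: distrib_left)
  have m: "max 1 N1 = N1" "max 1 N2 = N2" using N12 by simp_all
  have "t1 + 300 * k\<^sup>2 \<le> 600 * (k\<^sup>2 * N1) + 2 * (k * (k - length (In' @ [z])) * N1)"
    using assms(10) unfolding N1_def[symmetric] m .
  moreover have "t2 + 300 * k\<^sup>2 \<le> 600 * (k\<^sup>2 * N2) + 2 * (k * (k - length In') * N2)"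
    using assms(11) unfolding N2_def[symmetric] m .
  moreover have "update_time g z \<le> 2 + 2 * (k * N1)" using deg by (simp add: update_time_def)
  \<comment> \<open>Of the two credits of \<open>300 * k\<^sup>2\<close> one is passed on; the other
    covers \<open>25 * k\<^sup>2\<close> and the constant 2 of the update.\<close>
  ultimately show ?thesis using assms(12) q qN d1 d2 dN unfolding N_def[symmetric] by linarith
qed

text \<open>The first summand works as in \<open>lin_enum_v_time\<close>; its factor 600 leaves room
  for the \<open>400 * k\<^sup>2\<close> per graphlet of a call that switches to LIN-ENUM-V.\<close>

lemma enum_v_time:
  assumes "enum_v n k g In out t s" "state V v g In" "card V \<le> n" "0 < k" "length In \<le> k"
  shows "t + 300 * k\<^sup>2 \<le> 600 * (k\<^sup>2 * max 1 (card (completions g v k (set In)))) +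
    2 * (k * (k - length In) * max 1 (card (completions g v k (set In))))"
  using assms(1,2,5)
proof (induction rule: enum_v.induct)
  have q: "1 \<le> k\<^sup>2" "k \<le> k\<^sup>2" using assms(4) le_square_nat[of k] by simp_all
  have M: "k\<^sup>2 \<le> k\<^sup>2 * max 1 N" for N :: nat by simp
  {
    case (enum_full In g)
    show ?case using q M[of "card (completions g v k (set In))"] by linarith
  next
    case (enum_leaf In g In' ws t0 a us t1)
    note E = extend_call[OF enum_leaf(2,6,7,1)]
    note N = all_neighbours_props[OF enum_leaf(5) wf_adjD(2)[OF stateD(1)[OF E(1)]]]
    let ?N = "card (completions g v k (set In))"
    have "length us \<le> ?N" by (rule length_le_completions[OF E(1,2) enum_leaf(4) assms(4) N(1,2)])
    then have us: "k * length us \<le> k\<^sup>2 * max 1 ?N" using q(2) by (intro mult_le_mono) auto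
    have "t1 \<le> length In' * (length In' + length us + 1)" by (rule N(3))
    also have "\<dots> \<le> k * (k + length us)" using enum_leaf(4) assms(4) by (intro mult_le_mono) auto
    also have "\<dots> = k\<^sup>2 + k * length us" by (simp add: power2_eq_square algebra_simps)
    finally have "t1 \<le> k\<^sup>2 + k * length us" .
    moreover have "a \<le> k" using enum_leaf(3,4) by simp
    ultimately show ?case using q us M[of ?N] E(9) by linarith
  next
    case (enum_stuck In g In' t0 a)
    note E = extend_call[OF enum_stuck(2,5,6,1)]
    have "a \<le> k" using enum_stuck(3) E(5) by simp
    then show ?case using q M[of "card (completions g v k (set In))"] E(9) by linarith
  next
    case (enum_branch_first In g In' x y t0 a tx sx out1 t1 s1 out2 t2 s2)
    note prems = enum_branch_first(10,11)
    note E = extend_call[OF enum_branch_first(2) prems enum_branch_first(1)]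
    have len: "length In' < k - 1" "length In' < k" using E(5) enum_branch_first(4) by auto
    obtain u where u: "u \<in> set In'" "x \<in> set (g u)" "x \<notin> set In'" using E(7)[of x] by auto
    note X = mandatory_test_call[OF enum_branch_first(5) E(1) len(2) u(3)]
    have nm: "k \<le> card (component (del_vertex x g) (set In'))" using X(1) by (simp add: mandatory_def)
    have "a \<le> k" using enum_branch_first(3) len by simp
    then have cost: "1 + t0 + tx + 2 + a \<le> 25 * k\<^sup>2" using E(9) X(2) q by linarith
    have "length (In' @ [x]) \<le> k" using len by simp
    from enum_branch_time[OF prems(1) E(1,2,4) len(1) u nm
        enum_branch_first.IH(1)[OF state_add[OF E(1) u] this]
        enum_branch_first.IH(2)[OF state_delete[OF E(1) u(3)] less_imp_le[OF len(2)]] cost]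
    show ?case by linarith
  next
    case (enum_branch_second In g In' x y t0 a tx sx ty sy out1 t1 s1 out2 t2 s2)
    note prems = enum_branch_second(11,12)
    note E = extend_call[OF enum_branch_second(2) prems enum_branch_second(1)]
    have len: "length In' < k - 1" "length In' < k" using E(5) enum_branch_second(4) by auto
    obtain u where u: "u \<in> set In'" "y \<in> set (g u)" "y \<notin> set In'" using E(7)[of y] by auto
    have x: "x \<notin> set In'" using E(7)[of x] by auto
    note X = mandatory_test_call[OF enum_branch_second(5) E(1) len(2) x]
    note Y = mandatory_test_call[OF enum_branch_second(6) E(1) len(2) u(3)]
    have nm: "k \<le> card (component (del_vertex y g) (set In'))" using Y(1) by (simp add: mandatory_def)
    have "a \<le> k" using enum_branch_second(3) len by simp
    then have cost: "1 + t0 + tx + ty + 2 + a \<le> 25 * k\<^sup>2" using E(9) X(2) Y(2) q by linarith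
    have "length (In' @ [y]) \<le> k" using len by simp
    from enum_branch_time[OF prems(1) E(1,2,4) len(1) u nm
        enum_branch_second.IH(1)[OF state_add[OF E(1) u] this]
        enum_branch_second.IH(2)[OF state_delete[OF E(1) u(3)] less_imp_le[OF len(2)]] cost]
    show ?case by linarith
  next
    case (enum_lin In g In' x y t0 a tx sx ty sy out1 t1 s1)
    note prems = enum_lin(8,9)
    note E = extend_call[OF enum_lin(2) prems enum_lin(1)]
    have len: "length In' < k" using E(5) enum_lin(4) by auto
    obtain u where u: "u \<in> set In'" "x \<in> set (g u)" "x \<notin> set In'" using E(7)[of x] by auto
    obtain w where w: "w \<in> set In'" "y \<in> set (g w)" "y \<notin> set In'" using E(7)[of y] by auto
    note X = mandatory_test_call[OF enum_lin(5) E(1) len u(3)]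
    note Y = mandatory_test_call[OF enum_lin(6) E(1) len w(3)]
    have C: "card (component g (set In')) \<le> 2 * k"
      by (rule two_mandatory_component[OF E(1) _ _ _ u(3) w(3) u(1,2) w(1,2)])
         (use X(1) Y(1) E(6) in auto)
    let ?N = "card (completions g v k (set In))" and ?N' = "card (completions g v k (set In'))"
    have "?N' \<le> ?N" using E(2)
      by (intro card_mono finite_completions[OF stateD(1,2)[OF prems(1)]]) (auto simp: completions_def)
    then have "k\<^sup>2 * max 1 ?N' \<le> k\<^sup>2 * max 1 ?N" by (intro mult_le_mono2) auto
    moreover have "t1 + 200 * k\<^sup>2 \<le> 400 * (k\<^sup>2 * max 1 ?N')"
      by (rule lin_enum_v_time[OF enum_lin(7) E(1) assms(3,4) less_imp_le[OF len] C])
    moreover have "a \<le> k" using enum_lin(3) len by simp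
    ultimately show ?case using q M[of ?N] E(9) X(2) Y(2) by linarith
  }
qed

section \<open>From the input graph to the initial state, and the final constants\<close>

section \<open>The initial call\<close>

lemma wf_adj_adjacency_lists:
  assumes "simple_graph V E" "adjacency_lists V E g"
  shows "wf_adj V g"
proof -
  have e: "u \<in> V \<and> w \<in> V" if "{u, w} \<in> E" for u w
    using that assms(1) unfolding simple_graph_def by (metis doubleton_eq_iff)
  \<comment> \<open>This holds for every \<open>u\<close>: outside \<open>V\<close> the list is
    empty, and no edge has an endpoint there.\<close>
  have s: "w \<in> set (g u) \<longleftrightarrow> {u, w} \<in> E" for u w
    using assms(2) e[of u w] by (cases "u \<in> V") (auto simp: adjacency_lists_def)
  have "distinct (g u)" for u
    using assms(2) by (cases "u \<in> V") (auto simp: adjacency_lists_def)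
  moreover have "finite V" using assms(1) by (simp add: simple_graph_def)
  ultimately show ?thesis using s e unfolding wf_adj_def by (metis insert_commute subsetI)
qed

text \<open>Handshake bound, by double counting the incidences of vertices and edges.\<close>

lemma sum_degrees_le_edges:
  assumes "simple_graph V E" "adjacency_lists V E g"
  shows "(\<Sum>u\<in>V. length (g u)) \<le> 2 * card E"
proof -
  have finV: "finite V" using assms(1) by (simp add: simple_graph_def)
  have "E \<subseteq> Pow V" using assms(1) by (auto simp: simple_graph_def)
  then have finE: "finite E" using finV by (meson finite_Pow_iff finite_subset)
  have "(\<Sum>u\<in>V. length (g u)) = (\<Sum>u\<in>V. card (set (g u)))"
    using assms(2) by (intro sum.cong) (auto simp: adjacency_lists_def distinct_card[symmetric])
  also have "\<dots> \<le> (\<Sum>u\<in>V. card {e \<in> E. u \<in> e})"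
  proof (rule sum_mono)
    fix u assume u: "u \<in> V"
    have "inj_on (\<lambda>w. {u, w}) (set (g u))" by (auto simp: inj_on_def doubleton_eq_iff)
    then show "card (set (g u)) \<le> card {e \<in> E. u \<in> e}"
      using assms(2) u finE
      by (intro card_inj_on_le[where f = "\<lambda>w. {u, w}"]) (auto simp: adjacency_lists_def)
  qed
  also have "\<dots> = (\<Sum>e\<in>E. card {u \<in> V. u \<in> e})"
    using sum.swap_restrict[OF finV finE, of "\<lambda>_ _. 1 :: nat" "\<lambda>u e. u \<in> e"] by simp
  also have "\<dots> \<le> (\<Sum>e\<in>E. 2)"
  proof (rule sum_mono)
    fix e assume "e \<in> E"
    then obtain a b where "e = {a, b}" using assms(1) by (auto simp: simple_graph_def)
    then have "card {u \<in> V. u \<in> e} \<le> card {a, b}" by (intro card_mono) auto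
    also have "\<dots> \<le> 2" by (simp add: card_insert_if)
    finally show "card {u \<in> V. u \<in> e} \<le> 2" .
  qed
  finally show ?thesis by simp
qed

text \<open>Paths from \<open>v\<close> inside \<open>U\<close> survive when \<open>U\<close> grows,
  and a new vertex extends one of them. Symmetry then connects any two vertices through
  \<open>v\<close>.\<close>

lemma grown_connected:
  assumes "grown g v U" "\<And>x y. y \<in> set (g x) \<Longrightarrow> {x, y} \<in> E"
  shows "connected_graph U (induced_edges E U)"
proof -
  let ?R = "\<lambda>U. {(x, y). {x, y} \<in> induced_edges E U}"
  have "\<forall>u \<in> U. (v, u) \<in> (?R U)\<^sup>*"
    using assms(1)
  proof (induction rule: grown.induct)
    case (step U x y)
    have "(?R U)\<^sup>* \<subseteq> (?R (insert y U))\<^sup>*"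
      by (rule rtrancl_mono) (auto simp: induced_edges_def)
    then have *: "\<forall>u \<in> U. (v, u) \<in> (?R (insert y U))\<^sup>*" using step.IH by blast
    have "(x, y) \<in> ?R (insert y U)"
      using assms(2)[OF step.hyps(3)] step.hyps(2) by (auto simp: induced_edges_def)
    then have "(v, y) \<in> (?R (insert y U))\<^sup>*" using * step.hyps(2) by (meson rtrancl.rtrancl_into_rtrancl)
    then show ?case using * by blast
  qed simp
  moreover have "sym ((?R U)\<^sup>*)" by (intro sym_rtrancl) (auto simp: sym_def insert_commute)
  ultimately have "\<forall>u \<in> U. \<forall>w \<in> U. (u, w) \<in> (?R U)\<^sup>*" by (meson rtrancl_trans symD)
  then show ?thesis using grown_root[OF assms(1)] by (auto simp: connected_graph_def)
qed

text \<open>One inclusion is enough, because the number of completions occurs only in an upper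
  bound.\<close>

lemma completions_le_graphlets:
  assumes "simple_graph V E" "adjacency_lists V E g" "v \<in> V"
  shows "card (completions g v k {v}) \<le> card (graphlets_containing V E k v)"
proof (rule card_mono)
  note wf = wf_adj_adjacency_lists[OF assms(1,2)]
  have "graphlets_containing V E k v \<subseteq> Pow V"
    by (auto simp: graphlets_containing_def graphlets_def)
  then show "finite (graphlets_containing V E k v)"
    using wf_adjD(1)[OF wf] by (meson finite_Pow_iff finite_subset)
  have "{x, y} \<in> E" if "y \<in> set (g x)" for x y
    using that assms(2) by (cases "x \<in> V") (auto simp: adjacency_lists_def)
  then show "completions g v k {v} \<subseteq> graphlets_containing V E k v"
    using grown_subset[of g v _ V] assms(3) wf_adjD(3)[OF wf] grown_connected[of g v _ E]
    by (auto simp: completions_def graphlets_containing_def graphlets_def)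
qed

theorem theorem4:
  shows "\<exists>C :: nat. \<forall>(V :: nat set) E g k v.
    simple_graph V E \<and> connected_graph V E \<and> adjacency_lists V E g \<and> 0 < k \<and> v \<in> V \<longrightarrow>
      (\<exists>out t s. enum_v_call V g k v out t s) \<and>
      (\<forall>out t s. enum_v_call V g k v out t s \<longrightarrow>
         t \<le> C * (max 1 (card (graphlets_containing V E k v)) * k\<^sup>2) \<and>
         s \<le> C * (card V + card E))"
\<comment> \<open>The time needs 600 + 2. The space is at most
  \<open>20 * card V + 5 + 15 * ?D\<close>, which 700 covers because \<open>1 \<le> card V\<close>
  and \<open>?D \<le> 2 * card E\<close>.\<close>
proof (rule exI[of _ 700], intro allI impI)
  fix V :: "nat set" and E g and k v :: nat
  assume "simple_graph V E \<and> connected_graph V E \<and> adjacency_lists V E g \<and> 0 < k \<and> v \<in> V"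
  then have G: "simple_graph V E" "adjacency_lists V E g" and k: "0 < k" and v: "v \<in> V" by auto
  note wf = wf_adj_adjacency_lists[OF G]
  have S: "state V v g [v]" using wf v grown.root[of g v] by (simp add: state_def)
  have len: "length [v] \<le> k" using k by simp
  have V1: "1 \<le> card V" using v wf_adjD(1)[OF wf] by (metis One_nat_def Suc_leI card_gt_0_iff empty_iff)
  let ?D = "\<Sum>u\<in>V. length (g u)"
  have D: "?D \<le> 2 * card E" by (rule sum_degrees_le_edges[OF G])
  let ?N = "card (completions g v k (set [v]))" and ?N' = "card (graphlets_containing V E k v)"
  have "t \<le> 700 * (max 1 ?N' * k\<^sup>2) \<and> s \<le> 700 * (card V + card E)"
    if call: "enum_v_call V g k v out t s" for out t s
  proof
    obtain s' where s': "enum_v (card V) k g [v] out t s'"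
      "s = card V + 3 * ?D + 3 * card V + 1 + s'"
      using call by (auto simp: enum_v_call_def)
    have "?N \<le> ?N'" using completions_le_graphlets[OF G v] by simp
    then have N: "k\<^sup>2 * max 1 ?N \<le> k\<^sup>2 * max 1 ?N'" by (intro mult_le_mono2) auto
    \<comment> \<open>From the initial call, the charges for deletions are at most
      \<open>k\<^sup>2\<close> per graphlet, so they do not affect the order of the bound.\<close>
    have "k * (k - length [v]) * max 1 ?N \<le> k\<^sup>2 * max 1 ?N"
      by (intro mult_le_mono1) (simp add: power2_eq_square)
    then have "t \<le> 700 * (k\<^sup>2 * max 1 ?N')"
      using enum_v_time[OF s'(1) S order.refl k len] N by linarith
    then show "t \<le> 700 * (max 1 ?N' * k\<^sup>2)" by (simp only: mult.commute)
    have "card (undecided g [v]) \<le> card V"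
      using stateD(8)[OF S] wf_adjD(1)[OF wf] by (intro card_mono) (auto simp: undecided_def)
    moreover have "s' \<le> 4 + 4 * card (undecided g [v]) + 12 * (card V + ?D)"
      using enum_v_space[OF s'(1) S order.refl k len order.refl] unfolding sum.distrib by simp
    ultimately show "s \<le> 700 * (card V + card E)" using s'(2) D V1 by simp
  qed
  moreover have "\<exists>out t s. enum_v_call V g k v out t s"
    using enum_v_exists[OF S order.refl k len] by (auto simp: enum_v_call_def)
  ultimately show "(\<exists>out t s. enum_v_call V g k v out t s) \<and>
      (\<forall>out t s. enum_v_call V g k v out t s \<longrightarrow>
         t \<le> 700 * (max 1 ?N' * k\<^sup>2) \<and> s \<le> 700 * (card V + card E))" by blast
qed

end
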